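(* Let $W\in L^1((0,1)^2)$ be a graphon with $W(x,y)=W(y,x)\ge0$ for all $(x,y)\in(0,1)^2$ and $\int_0^1W(x,y)\,dy\le1$ for a.e. $x\in(0,1)$. Let $\Phi:\mathbb{R}\to\mathbb{R}$ satisfy $\Phi(0)=0$ and be Lipschitz continuous on all of $\mathbb{R}$ with a constant $K$. Let $p\in[1,\infty)$ and $u_0\in L^p((0,1))$. Then for any $T>0$, the graphon reaction--diffusion equation $$\partial_tu=\mathcal{L}^Wu+\Phi(u)$$ with initial condition $u(x,0)=u_0(x)$ has a unique classical solution $u\in C^1([0,T];L^p((0,1)))$, and it satisfies the mild formulation $$u(\cdot,t)=e^{t\mathcal{L}^W}u_0+\int_0^te^{(t-s)\mathcal{L}^W}\Phi(u(\cdot,s))\,ds.$$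
   Context: The graphon diffusion operator is $\mathcal{L}^W u(x)=\int_0^1 W(x,y)\,(u(y)-u(x))\,dy$; under the stated hypotheses on $W$ it is a bounded linear operator on $L^p((0,1))$ for every $p\in[1,\infty]$, and $\{e^{t\mathcal{L}^W}\}_{t\ge0}$ denotes the uniformly continuous semigroup it generates. $\Phi(u)$ denotes the pointwise composition $x\mapsto\Phi(u(x,t))$. A classical solution is one for which the equation holds as an identity in $L^p((0,1))$ for $t\in[0,T]$. *)

theory Defs
  imports "HOL-Analysis.Analysis"
begin

abbreviation unit_leb :: "real measure" where
  "unit_leb \<equiv> lebesgue_on {0<..<1}"

definition ae_eq :: "(real \<Rightarrow> real) \<Rightarrow> (real \<Rightarrow> real) \<Rightarrow> bool" where
  "ae_eq f g \<longleftrightarrow> f \<in> borel_measurable unit_leb \<and> g \<in> borel_measurable unit_leb \<and>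
     (AE x in unit_leb. f x = g x)"

text \<open>
  Since the norm depends on the real number \<open>p\<close>, the spaces \<open>L\<^sup>p((0,1))\<close> are not types of their own.
  They are subspaces of the vector space \<open>L0\<close> of all Lebesgue measurable functions on \<open>(0,1)\<close>
  modulo equality almost everywhere, so that equality of their elements is ordinary equality.
\<close>

quotient_type L0 = "real \<Rightarrow> real" / partial: ae_eq
proof (rule part_equivpI)
  show "\<exists>x. ae_eq x x"
    by (rule exI[of _ "\<lambda>_. 0"]) (simp add: ae_eq_def)
  show "symp ae_eq"
    by (auto simp: symp_def ae_eq_def)
  show "transp ae_eq"
    unfolding transp_def ae_eq_def by (auto elim: AE_mp)
qed

instantiation L0 :: real_vector
begin

lift_definition zero_L0 :: L0 is "\<lambda>_. 0"
  by (simp add: ae_eq_def)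

lift_definition plus_L0 :: "L0 \<Rightarrow> L0 \<Rightarrow> L0" is "\<lambda>f g x. f x + g x"
  unfolding ae_eq_def by auto

lift_definition uminus_L0 :: "L0 \<Rightarrow> L0" is "\<lambda>f x. - f x"
  unfolding ae_eq_def by auto

lift_definition minus_L0 :: "L0 \<Rightarrow> L0 \<Rightarrow> L0" is "\<lambda>f g x. f x - g x"
  unfolding ae_eq_def by auto

lift_definition scaleR_L0 :: "real \<Rightarrow> L0 \<Rightarrow> L0" is "\<lambda>c f x. c * f x"
  unfolding ae_eq_def by auto

instance
  by standard (transfer; auto simp: ae_eq_def algebra_simps)+

end

subsection \<open>The normed spaces \<open>L\<^sup>p((0,1))\<close>, for \<open>1 \<le> p < \<infinity>\<close>\<close>

lift_definition in_Lp :: "real \<Rightarrow> L0 \<Rightarrow> bool" is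
  "\<lambda>p f. integrable unit_leb (\<lambda>x. \<bar>f x\<bar> powr p)"
  unfolding ae_eq_def by (intro integrable_cong_AE) auto

definition Lp :: "real \<Rightarrow> L0 set" where
  "Lp p = {f. in_Lp p f}"

text \<open>Outside \<open>Lp p\<close> this is the junk value 0, whence the membership conditions in what follows.\<close>

lift_definition Lp_norm :: "real \<Rightarrow> L0 \<Rightarrow> real" is
  "\<lambda>p f. (\<integral>x. \<bar>f x\<bar> powr p \<partial>unit_leb) powr (1 / p)"
  unfolding ae_eq_def by (intro arg_cong2[where f = "(powr)"] integral_cong_AE) auto

definition Lp_tendsto :: "real \<Rightarrow> ('a \<Rightarrow> L0) \<Rightarrow> L0 \<Rightarrow> 'a filter \<Rightarrow> bool" where
  "Lp_tendsto p F l G \<longleftrightarrow> l \<in> Lp p \<and> (\<forall>\<^sub>F s in G. F s \<in> Lp p) \<and>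
     ((\<lambda>s. Lp_norm p (F s - l)) \<longlongrightarrow> 0) G"

definition Lp_continuous_on :: "real \<Rightarrow> real set \<Rightarrow> (real \<Rightarrow> L0) \<Rightarrow> bool" where
  "Lp_continuous_on p S F \<longleftrightarrow> (\<forall>t\<in>S. Lp_tendsto p F (F t) (at t within S))"

definition Lp_has_derivative :: "real \<Rightarrow> (real \<Rightarrow> L0) \<Rightarrow> L0 \<Rightarrow> real \<Rightarrow> real set \<Rightarrow> bool" where
  "Lp_has_derivative p F F' t S \<longleftrightarrow>
     Lp_tendsto p (\<lambda>s. (1 / (s - t)) *\<^sub>R (F s - F t)) F' (at t within S)"

definition Lp_C1_on :: "real \<Rightarrow> real set \<Rightarrow> (real \<Rightarrow> L0) \<Rightarrow> bool" where
  "Lp_C1_on p S F \<longleftrightarrow> (\<forall>t\<in>S. F t \<in> Lp p) \<and>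
     (\<exists>F'. (\<forall>t\<in>S. Lp_has_derivative p F (F' t) t S) \<and> Lp_continuous_on p S F')"

text \<open>
  The \<open>Lp p\<close>-valued Bochner integral. This is \<^const>\<open>has_bochner_integral\<close> with the norm replaced by
  the one of \<open>Lp p\<close>; as \<open>Lp p\<close> is separable, the first conjunct after membership is Borel
  measurability of \<open>F\<close>.
\<close>

definition Lp_has_integral :: "real \<Rightarrow> 'a measure \<Rightarrow> ('a \<Rightarrow> L0) \<Rightarrow> L0 \<Rightarrow> bool" where
  "Lp_has_integral p M F I \<longleftrightarrow>
     (\<forall>s\<in>space M. F s \<in> Lp p) \<and>
     (\<forall>g\<in>Lp p. (\<lambda>s. Lp_norm p (F s - g)) \<in> borel_measurable M) \<and>
     (\<exists>\<sigma>. (\<forall>i. Bochner_Integration.simple_bochner_integrable M (\<sigma> i) \<and> (\<forall>s\<in>space M. \<sigma> i s \<in> Lp p)) \<and>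
          (\<lambda>i. \<integral>\<^sup>+s. ennreal (Lp_norm p (F s - \<sigma> i s)) \<partial>M) \<longlonglongrightarrow> 0 \<and>
          Lp_tendsto p (\<lambda>i. Bochner_Integration.simple_bochner_integral M (\<sigma> i)) I sequentially)"

subsection \<open>Bounded operators and uniformly continuous semigroups\<close>

definition Lp_bounded_linear :: "real \<Rightarrow> (L0 \<Rightarrow> L0) \<Rightarrow> bool" where
  "Lp_bounded_linear p A \<longleftrightarrow>
     (\<forall>f\<in>Lp p. A f \<in> Lp p) \<and>
     (\<forall>f\<in>Lp p. \<forall>g\<in>Lp p. A (f + g) = A f + A g) \<and>
     (\<forall>c. \<forall>f\<in>Lp p. A (c *\<^sub>R f) = c *\<^sub>R A f) \<and>
     (\<exists>C. \<forall>f\<in>Lp p. Lp_norm p (A f) \<le> C * Lp_norm p f)"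

definition Lp_opnorm :: "real \<Rightarrow> (L0 \<Rightarrow> L0) \<Rightarrow> real" where
  "Lp_opnorm p A = (SUP f\<in>{f \<in> Lp p. Lp_norm p f \<le> 1}. Lp_norm p (A f))"

definition uniformly_continuous_semigroup :: "real \<Rightarrow> (real \<Rightarrow> L0 \<Rightarrow> L0) \<Rightarrow> bool" where
  "uniformly_continuous_semigroup p S \<longleftrightarrow>
     (\<forall>t\<ge>0. Lp_bounded_linear p (S t)) \<and>
     (\<forall>f\<in>Lp p. S 0 f = f) \<and>
     (\<forall>s\<ge>0. \<forall>t\<ge>0. \<forall>f\<in>Lp p. S (s + t) f = S s (S t f)) \<and>
     ((\<lambda>h. Lp_opnorm p (\<lambda>f. S h f - f)) \<longlongrightarrow> 0) (at_right 0)"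

definition is_generator :: "real \<Rightarrow> (L0 \<Rightarrow> L0) \<Rightarrow> (real \<Rightarrow> L0 \<Rightarrow> L0) \<Rightarrow> bool" where
  "is_generator p A S \<longleftrightarrow>
     (\<forall>f\<in>Lp p. Lp_tendsto p (\<lambda>h. (1 / h) *\<^sub>R (S h f - f)) (A f) (at_right 0))"

text \<open>
  \<open>e\<^sup>t\<^sup>A\<close> for a bounded linear operator \<open>A\<close> on \<open>Lp p\<close>. The semigroup is determined by its
  generator for times \<open>t \<ge> 0\<close> and arguments in \<open>Lp p\<close>; the choice only concerns values elsewhere.
\<close>

definition Lp_semigroup :: "real \<Rightarrow> (L0 \<Rightarrow> L0) \<Rightarrow> real \<Rightarrow> L0 \<Rightarrow> L0" where
  "Lp_semigroup p A = (SOME S. uniformly_continuous_semigroup p S \<and> is_generator p A S)"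

subsection \<open>The graphon reaction--diffusion equation\<close>

text \<open>
  Changing the representative of \<open>u\<close> on a null set changes the functions below on a null set only,
  so the chosen representative \<open>rep_L0 u\<close> is immaterial. As \<open>abs_L0\<close> is meaningful on measurable
  functions only, measurability has to follow from the hypotheses on \<open>W\<close>, \<open>\<Phi>\<close> and \<open>u\<close>.
\<close>

definition graphon_op :: "(real \<Rightarrow> real \<Rightarrow> real) \<Rightarrow> L0 \<Rightarrow> L0" where
  "graphon_op W u =
     abs_L0 (\<lambda>x. \<integral>y. W x y * (rep_L0 u y - rep_L0 u x) \<partial>unit_leb)"

definition compose_L0 :: "(real \<Rightarrow> real) \<Rightarrow> L0 \<Rightarrow> L0" where
  "compose_L0 \<Phi> u = abs_L0 (\<lambda>x. \<Phi> (rep_L0 u x))"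

definition classical_solution ::
  "real \<Rightarrow> (real \<Rightarrow> real \<Rightarrow> real) \<Rightarrow> (real \<Rightarrow> real) \<Rightarrow> L0 \<Rightarrow> real \<Rightarrow> (real \<Rightarrow> L0) \<Rightarrow> bool" where
  "classical_solution p W \<Phi> u0 T u \<longleftrightarrow>
     Lp_C1_on p {0..T} u \<and> u 0 = u0 \<and>
     (\<forall>t\<in>{0..T}.
        Lp_has_derivative p u (graphon_op W (u t) + compose_L0 \<Phi> (u t)) t {0..T})"

definition mild_formulation ::
  "real \<Rightarrow> (real \<Rightarrow> real \<Rightarrow> real) \<Rightarrow> (real \<Rightarrow> real) \<Rightarrow> L0 \<Rightarrow> real \<Rightarrow> (real \<Rightarrow> L0) \<Rightarrow> bool" where
  "mild_formulation p W \<Phi> u0 T u \<longleftrightarrow>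
     (\<forall>t\<in>{0..T}. \<exists>I.
        Lp_has_integral p (lebesgue_on {0..t})
          (\<lambda>s. Lp_semigroup p (graphon_op W) (t - s) (compose_L0 \<Phi> (u s))) I \<and>
        u t = Lp_semigroup p (graphon_op W) t u0 + I)"

end

theory Submission
  imports Defs
begin

text \<open>
  By Schur's test the graphon operator \<open>A\<close> is bounded on every \<open>L\<^sup>p((0,1))\<close>, and \<open>u \<mapsto> \<Phi> \<circ> u\<close> is
  \<open>K\<close>-Lipschitz there, so the equation is an ordinary differential equation in a Banach space with
  a globally Lipschitz right-hand side. The Picard operator contracts a weighted supremum norm on
  \<open>[0,T]\<close>, which gives existence and uniqueness. Since \<open>A\<close> is bounded, its semigroup is the
  exponential series, and integrating the derivative of \<open>s \<mapsto> e\<^bsup>(t-s)A\<^esup> u(s)\<close> gives the mild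
  formulation. The calculus takes place in one Banach space that contains \<open>L\<^sup>p((0,1))\<close> for all
  \<open>p\<close>.
\<close>

subsection \<open>Inequalities for powers\<close>

text \<open>As \<open>p\<close> is a real variable, \<open>Lp p\<close> is a set and not a type,
  whereas derivatives, exponentials and fixed points are notions for types. Hence the detour through
  \<open>Lp_family\<close>, whose price is that whatever is built there must be shown to stay in the
  range of \<open>emb\<close>: for the exponential because \<open>emb \<circ> prj\<close> commutes
  with the generator, for the solution because of uniqueness. \<open>Lp_semigroup\<close> is
  selected by \<open>SOME\<close>, so only its defining properties can be used. The exponential
  shows that such a semigroup exists, and every other candidate has to be proved equal to it. The
  generator controls right derivatives only; the left ones depend on the norm continuity of the
  semigroup. \<open>W\<close> is Lebesgue measurable on the square, while Tonelli's theorem speaks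
  of a product measure. \<open>W\<close> is therefore replaced by a Borel kernel that agrees with it
  almost everywhere. Symmetry turns the bound on the row integrals into one on the column integrals,
  and Schur's test needs both.\<close>

lemma powr_above_tangent:
  fixes a c p :: real
  assumes "0 \<le> a" "0 \<le> c" "1 \<le> p"
  shows "c powr p + p * c powr (p - 1) * (a - c) \<le> a powr p"
proof (cases "c = 0 \<or> a = 0")
  case True
  \<comment> \<open>For \<open>a = 0\<close> the tangent at \<open>c\<close> has the value
    \<open>(1 - p) * c powr p\<close>. This case and \<open>c = 0\<close> are treated apart because
    the convexity criterion below is applied on the open half-line.\<close>
  moreover have "c powr p - p * c powr (p - 1) * c \<le> 0" if "c > 0"
  proof -
    have "c powr (p - 1) * c = c powr p"
      using that by (simp add: powr_diff)
    moreover have "c powr p \<le> p * c powr p"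
      using assms that by simp
    ultimately show ?thesis
      by (simp add: mult.assoc)
  qed
  ultimately show ?thesis
    using assms by (cases "c = 0") auto
next
  case False
  then have pos: "0 < a" "0 < c"
    using assms by auto
  have "p * c powr (p - 1) * (a - c) \<le> a powr p - c powr p"
  proof (rule convex_on_imp_above_tangent[where A = "{0<..}" and f = "\<lambda>x. x powr p"])
    show "convex_on {0<..} (\<lambda>x. x powr p)"
      using assms by (intro powr_convex)
    show "connected {0::real<..}"
      by auto
    show "c \<in> interior {0<..}"
      using pos by (simp add: interior_open)
    show "((\<lambda>x. x powr p) has_real_derivative p * c powr (p - 1)) (at c within {0<..})"
      using pos by (auto intro!: derivative_eq_intros)
  qed (use pos in auto)
  then show ?thesis
    by simp
qed

text \<open>Averaging the tangent inequalities for \<open>a\<close> and \<open>b\<close> at the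
  point \<open>c\<close> makes the linear terms cancel.\<close>

lemma powr_convex_combination:
  fixes a b p t :: real
  assumes "0 \<le> a" "0 \<le> b" "1 \<le> p" "0 \<le> t" "t \<le> 1"
  shows "(t * a + (1 - t) * b) powr p \<le> t * a powr p + (1 - t) * b powr p"
proof -
  define c where "c = t * a + (1 - t) * b"
  have "0 \<le> c"
    using assms by (auto simp: c_def)
  then have "t * (c powr p + p * c powr (p - 1) * (a - c))
      + (1 - t) * (c powr p + p * c powr (p - 1) * (b - c)) \<le> t * a powr p + (1 - t) * b powr p"
    using assms by (intro add_mono mult_left_mono powr_above_tangent) auto
  moreover have "t * (c powr p + p * c powr (p - 1) * (a - c))
      + (1 - t) * (c powr p + p * c powr (p - 1) * (b - c))
      = c powr p + p * c powr (p - 1) * (t * a + (1 - t) * b - c)"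
    by (simp add: algebra_simps)
  ultimately show ?thesis
    by (simp add: c_def)
qed

lemma le_one_plus_powr:
  fixes a p :: real
  assumes "0 \<le> a" "1 \<le> p"
  shows "a \<le> 1 + a powr p"
proof (cases "a \<le> 1")
  case False
  then have "a powr 1 \<le> a powr p"
    using assms by (intro powr_mono) auto
  then show ?thesis
    using False by simp
qed (use powr_ge_zero[of a p] in linarith)

lemma powr_inverse_le_iff:
  fixes a b p :: real
  assumes "0 \<le> a" "0 \<le> b" "0 < p"
  shows "a powr (1 / p) \<le> b \<longleftrightarrow> a \<le> b powr p"
proof
  assume "a powr (1 / p) \<le> b"
  then have "(a powr (1 / p)) powr p \<le> b powr p"
    using assms by (intro powr_mono2) auto
  then show "a \<le> b powr p"
    using assms by (simp add: powr_powr)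
next
  assume "a \<le> b powr p"
  then have "a powr (1 / p) \<le> (b powr p) powr (1 / p)"
    using assms by (intro powr_mono2) auto
  then show "a powr (1 / p) \<le> b"
    using assms by (simp add: powr_powr)
qed

text \<open>Jensen's inequality for a weight of total mass at most 1: the tangent inequality at
  \<open>c\<close>, the weighted mean of \<open>\<bar>f\<bar>\<close>, is integrated against
  \<open>k\<close>.\<close>

lemma jensen_powr:
  fixes k f :: "'a \<Rightarrow> real" and p :: real
  assumes p: "1 \<le> p" and [measurable]: "f \<in> borel_measurable M"
    and k: "integrable M k" and k_nonneg: "\<And>x. 0 \<le> k x" and mass: "(\<integral>x. k x \<partial>M) \<le> 1"
    and kf: "integrable M (\<lambda>x. k x * \<bar>f x\<bar> powr p)"
  shows "integrable M (\<lambda>x. k x * f x)"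
    and "\<bar>\<integral>x. k x * f x \<partial>M\<bar> powr p \<le> (\<integral>x. k x * \<bar>f x\<bar> powr p \<partial>M)"
proof -
  have [measurable]: "k \<in> borel_measurable M"
    using k by simp
  show int: "integrable M (\<lambda>x. k x * f x)"
  proof (rule Bochner_Integration.integrable_bound)
    show "integrable M (\<lambda>x. k x + k x * \<bar>f x\<bar> powr p)"
      using k kf by simp
    have "\<bar>k x * f x\<bar> \<le> \<bar>k x + k x * \<bar>f x\<bar> powr p\<bar>" for x
    proof -
      have "k x * \<bar>f x\<bar> \<le> k x * (1 + \<bar>f x\<bar> powr p)"
        using p k_nonneg by (intro mult_left_mono le_one_plus_powr) auto
      then show ?thesis
        using k_nonneg[of x] by (simp add: abs_mult distrib_left)
    qed
    then show "AE x in M. norm (k x * f x) \<le> norm (k x + k x * \<bar>f x\<bar> powr p)"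
      by simp
  qed simp
  have int': "integrable M (\<lambda>x. k x * \<bar>f x\<bar>)"
    using integrable_abs[OF int] k_nonneg by (simp add: abs_mult)
  define m c where "m = (\<integral>x. k x \<partial>M)" and "c = (\<integral>x. k x * \<bar>f x\<bar> \<partial>M)"
  have "0 \<le> c"
    using k_nonneg by (auto simp: c_def intro!: integral_nonneg_AE)
  have cc: "c powr (p - 1) * c = c powr p"
    using \<open>0 \<le> c\<close> by (cases "c = 0") (simp_all add: powr_diff)
  have "\<bar>\<integral>x. k x * f x \<partial>M\<bar> \<le> c"
    using integral_abs_bound[of M "\<lambda>x. k x * f x"] k_nonneg by (simp add: abs_mult c_def)
  then have "\<bar>\<integral>x. k x * f x \<partial>M\<bar> powr p \<le> c powr p"
    using p by (intro powr_mono2) auto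
  \<comment> \<open>The two sides differ by \<open>(p - 1) * (1 - m) * c powr p\<close>. Here the
    mass may be smaller than 1.\<close>
  also have "\<dots> \<le> m * c powr p + p * c powr (p - 1) * (c - m * c)"
  proof -
    have "0 \<le> (p - 1) * (1 - m) * c powr p"
      using p mass by (simp add: m_def)
    moreover have "m * c powr p + p * c powr (p - 1) * (c - m * c)
        = m * c powr p + p * (1 - m) * c powr p"
      by (simp add: cc[symmetric] algebra_simps)
    ultimately show ?thesis
      by (simp add: algebra_simps)
  qed
  also have "\<dots> = (\<integral>x. k x * (c powr p + p * c powr (p - 1) * (\<bar>f x\<bar> - c)) \<partial>M)"
  proof -
    have "(\<integral>x. k x * (c powr p + p * c powr (p - 1) * (\<bar>f x\<bar> - c)) \<partial>M)
        = (\<integral>x. k x * (c powr p) + (p * c powr (p - 1)) * (k x * \<bar>f x\<bar> - k x * c) \<partial>M)"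
      by (intro Bochner_Integration.integral_cong) (auto simp: algebra_simps)
    also have "\<dots> = m * c powr p + p * c powr (p - 1) * (c - m * c)"
      using k int' by (simp add: m_def c_def)
    finally show ?thesis
      by simp
  qed
  also have "\<dots> \<le> (\<integral>x. k x * \<bar>f x\<bar> powr p \<partial>M)"
  proof (rule integral_mono)
    have "integrable M (\<lambda>x. k x * (c powr p) + (p * c powr (p - 1)) * (k x * \<bar>f x\<bar> - k x * c))"
      using k int' by simp
    then show "integrable M (\<lambda>x. k x * (c powr p + p * c powr (p - 1) * (\<bar>f x\<bar> - c)))"
      by (simp add: algebra_simps)
    show "k x * (c powr p + p * c powr (p - 1) * (\<bar>f x\<bar> - c)) \<le> k x * \<bar>f x\<bar> powr p" for x
      using p k_nonneg \<open>0 \<le> c\<close> by (intro mult_left_mono powr_above_tangent) auto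
  qed fact
  finally show "\<bar>\<integral>x. k x * f x \<partial>M\<bar> powr p \<le> (\<integral>x. k x * \<bar>f x\<bar> powr p \<partial>M)" .
qed

text \<open>The dominating function comes from convexity at the midpoint of
  \<open>\<bar>f x\<bar>\<close> and \<open>\<bar>g x\<bar>\<close>; the factor 2 turns the midpoint
  back into the sum.\<close>

lemma integrable_powr_add:
  fixes f g :: "'a \<Rightarrow> real"
  assumes p: "1 \<le> p" and [measurable]: "f \<in> borel_measurable M" "g \<in> borel_measurable M"
    and f: "integrable M (\<lambda>x. \<bar>f x\<bar> powr p)" and g: "integrable M (\<lambda>x. \<bar>g x\<bar> powr p)"
  shows "integrable M (\<lambda>x. \<bar>f x + g x\<bar> powr p)"
proof (rule Bochner_Integration.integrable_bound)
  show "integrable M (\<lambda>x. 2 powr p * (\<bar>f x\<bar> powr p + \<bar>g x\<bar> powr p))"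
    using f g by simp
  have "\<bar>f x + g x\<bar> powr p \<le> 2 powr p * (\<bar>f x\<bar> powr p + \<bar>g x\<bar> powr p)" for x
  proof -
    have "\<bar>f x + g x\<bar> powr p \<le> (2 * (1/2 * \<bar>f x\<bar> + (1 - 1/2) * \<bar>g x\<bar>)) powr p"
      using p by (intro powr_mono2) auto
    also have "\<dots> = 2 powr p * (1/2 * \<bar>f x\<bar> + (1 - 1/2) * \<bar>g x\<bar>) powr p"
      by (rule powr_mult)
    also have "\<dots> \<le> 2 powr p * (1/2 * \<bar>f x\<bar> powr p + (1 - 1/2) * \<bar>g x\<bar> powr p)"
      using p by (intro mult_left_mono powr_convex_combination) auto
    also have "\<dots> \<le> 2 powr p * (\<bar>f x\<bar> powr p + \<bar>g x\<bar> powr p)"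
      by (intro mult_left_mono add_mono) auto
    finally show ?thesis .
  qed
  then show "AE x in M. norm (\<bar>f x + g x\<bar> powr p) \<le> norm (2 powr p * (\<bar>f x\<bar> powr p + \<bar>g x\<bar> powr p))"
    by simp
qed simp

text \<open>For \<open>\<alpha>\<close> and \<open>\<beta>\<close> above the two norms,
  \<open>\<bar>f\<bar> + \<bar>g\<bar>\<close> is \<open>\<alpha> + \<beta>\<close> times a convex
  combination of \<open>\<bar>f\<bar> / \<alpha>\<close> and \<open>\<bar>g\<bar> / \<beta>\<close>,
  to which convexity of the power applies. Choosing them strictly above the norms avoids division by
  a vanishing norm.\<close>

lemma minkowski:
  fixes f g :: "'a \<Rightarrow> real"
  assumes p: "1 \<le> p" and [measurable]: "f \<in> borel_measurable M" "g \<in> borel_measurable M"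
    and f: "integrable M (\<lambda>x. \<bar>f x\<bar> powr p)" and g: "integrable M (\<lambda>x. \<bar>g x\<bar> powr p)"
  shows "(\<integral>x. \<bar>f x + g x\<bar> powr p \<partial>M) powr (1 / p)
    \<le> (\<integral>x. \<bar>f x\<bar> powr p \<partial>M) powr (1 / p) + (\<integral>x. \<bar>g x\<bar> powr p \<partial>M) powr (1 / p)"
    (is "?N \<le> ?A + ?B")
proof -
  have bound: "?N \<le> \<alpha> + \<beta>" if \<alpha>: "?A < \<alpha>" and \<beta>: "?B < \<beta>" for \<alpha> \<beta>
  proof -
    have pos: "0 < \<alpha>" "0 < \<beta>"
      using that powr_ge_zero le_less_trans by blast+
    have fa: "(\<integral>x. \<bar>f x\<bar> powr p \<partial>M) \<le> \<alpha> powr p" and gb: "(\<integral>x. \<bar>g x\<bar> powr p \<partial>M) \<le> \<beta> powr p"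
      using p pos less_imp_le[OF \<alpha>] less_imp_le[OF \<beta>] by (subst (asm) powr_inverse_le_iff; force)+
    define t where "t = \<alpha> / (\<alpha> + \<beta>)"
    have t: "0 \<le> t" "t \<le> 1" "1 - t = \<beta> / (\<alpha> + \<beta>)"
      using pos by (auto simp: t_def field_simps)
    let ?h = "\<lambda>x. (\<alpha> + \<beta>) powr p * (t * (\<bar>f x\<bar> powr p / \<alpha> powr p) + (1 - t) * (\<bar>g x\<bar> powr p / \<beta> powr p))"
    have "\<bar>f x + g x\<bar> powr p \<le> ?h x" for x
    proof -
      have eq: "(\<alpha> + \<beta>) * (t * (\<bar>f x\<bar> / \<alpha>) + (1 - t) * (\<bar>g x\<bar> / \<beta>)) = \<bar>f x\<bar> + \<bar>g x\<bar>"
      proof -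
        have "(\<alpha> + \<beta>) * t = \<alpha>" "(\<alpha> + \<beta>) * (1 - t) = \<beta>"
          using pos t(3) by (auto simp: t_def)
        then show ?thesis
          using pos by (simp add: distrib_left mult.assoc[symmetric])
      qed
      have "\<bar>f x + g x\<bar> powr p \<le> (\<bar>f x\<bar> + \<bar>g x\<bar>) powr p"
        using p by (intro powr_mono2) auto
      also have "\<dots> = (\<alpha> + \<beta>) powr p * (t * (\<bar>f x\<bar> / \<alpha>) + (1 - t) * (\<bar>g x\<bar> / \<beta>)) powr p"
        unfolding eq[symmetric] using pos t by (intro powr_mult)
      also have "\<dots> \<le> (\<alpha> + \<beta>) powr p * (t * (\<bar>f x\<bar> / \<alpha>) powr p + (1 - t) * (\<bar>g x\<bar> / \<beta>) powr p)"
        using p pos t by (intro mult_left_mono powr_convex_combination) auto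
      also have "\<dots> = ?h x"
        using pos by (simp add: powr_divide)
      finally show ?thesis .
    qed
    then have "(\<integral>x. \<bar>f x + g x\<bar> powr p \<partial>M) \<le> (\<integral>x. ?h x \<partial>M)"
      using assms by (intro integral_mono integrable_powr_add) auto
    also have "\<dots> = (\<alpha> + \<beta>) powr p * (t * ((\<integral>x. \<bar>f x\<bar> powr p \<partial>M) / \<alpha> powr p)
        + (1 - t) * ((\<integral>x. \<bar>g x\<bar> powr p \<partial>M) / \<beta> powr p))"
      using f g by simp
    also have "\<dots> \<le> (\<alpha> + \<beta>) powr p * (t * 1 + (1 - t) * 1)"
      using t pos fa gb by (intro mult_left_mono add_mono) auto
    also have "\<dots> = (\<alpha> + \<beta>) powr p"
      by simp
    finally show ?thesis
      using p pos by (subst powr_inverse_le_iff) auto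
  qed
  show ?thesis
  proof (rule field_le_epsilon)
    fix e :: real assume "0 < e"
    then show "?N \<le> ?A + ?B + e"
      using bound[of "?A + e / 2" "?B + e / 2"] by simp
  qed
qed

text \<open>Fatou's lemma for the powers. It places the pointwise limit in
  \<open>Lp_complete\<close> into \<open>Lp p\<close> and estimates its distance from the
  sequence.\<close>

lemma fatou_powr:
  fixes f :: "nat \<Rightarrow> 'a \<Rightarrow> real"
  assumes [measurable]: "\<And>n. f n \<in> borel_measurable M" "g \<in> borel_measurable M"
    and f: "\<And>n. integrable M (\<lambda>x. \<bar>f n x\<bar> powr p)" and le: "\<And>n. (\<integral>x. \<bar>f n x\<bar> powr p \<partial>M) \<le> C"
    and lim: "AE x in M. (\<lambda>n. f n x) \<longlonglongrightarrow> g x" and p: "0 < p"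
  shows "integrable M (\<lambda>x. \<bar>g x\<bar> powr p)" "(\<integral>x. \<bar>g x\<bar> powr p \<partial>M) \<le> C"
proof -
  have "0 \<le> C"
    by (rule order_trans[OF _ le]) (auto intro: integral_nonneg_AE)
  have "(\<integral>\<^sup>+x. ennreal (\<bar>g x\<bar> powr p) \<partial>M) = (\<integral>\<^sup>+x. liminf (\<lambda>n. ennreal (\<bar>f n x\<bar> powr p)) \<partial>M)"
  proof (rule nn_integral_cong_AE)
    show "AE x in M. ennreal (\<bar>g x\<bar> powr p) = liminf (\<lambda>n. ennreal (\<bar>f n x\<bar> powr p))"
      using lim
    proof eventually_elim
      case (elim x)
      have "(\<lambda>n. ennreal (\<bar>f n x\<bar> powr p)) \<longlonglongrightarrow> ennreal (\<bar>g x\<bar> powr p)"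
        using p by (intro tendsto_ennrealI tendsto_powr' tendsto_rabs elim tendsto_const) auto
      then show ?case
        by (intro lim_imp_Liminf[symmetric]) simp
    qed
  qed
  also have "\<dots> \<le> liminf (\<lambda>n. \<integral>\<^sup>+x. ennreal (\<bar>f n x\<bar> powr p) \<partial>M)"
    by (intro nn_integral_liminf) simp
  also have "\<dots> \<le> liminf (\<lambda>n::nat. ennreal C)"
    using f le by (intro Liminf_mono always_eventually allI) (simp add: nn_integral_eq_integral ennreal_leI)
  finally have le: "(\<integral>\<^sup>+x. ennreal (\<bar>g x\<bar> powr p) \<partial>M) \<le> ennreal C"
    by (simp add: Liminf_const)
  then show "integrable M (\<lambda>x. \<bar>g x\<bar> powr p)"
    by (intro integrableI_bounded) (auto simp: le_less_trans)
  then show "(\<integral>x. \<bar>g x\<bar> powr p \<partial>M) \<le> C"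
    using le \<open>0 \<le> C\<close> by (simp add: nn_integral_eq_integral)
qed

subsection \<open>The spaces \<open>L\<^sup>p((0,1))\<close>\<close>

lemma prob_unit_leb [simp]: "measure unit_leb {0<..<1} = 1"
  by (simp add: measure_restrict_space)

lemma finite_measure_unit_leb: "finite_measure unit_leb"
  by (intro finite_measure_lebesgue_on) simp

lemma integrable_const_unit_leb [simp]: "integrable unit_leb (\<lambda>_. c :: real)"
  by (intro finite_measure.integrable_const finite_measure_unit_leb)

lemma ae_eq_refl_iff: "ae_eq f f \<longleftrightarrow> f \<in> borel_measurable unit_leb"
  by (simp add: ae_eq_def)

lemma abs_L0_eqI: "ae_eq f g \<Longrightarrow> abs_L0 f = abs_L0 g"
  by (rule Quotient3_rel_abs[OF Quotient3_L0])

lemma abs_rep_L0 [simp]: "abs_L0 (rep_L0 u) = u"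
  by (rule Quotient3_abs_rep[OF Quotient3_L0])

lemma borel_measurable_rep_L0 [measurable, simp]: "rep_L0 u \<in> borel_measurable unit_leb"
  using Quotient3_rep_reflp[OF Quotient3_L0, of u] by (simp add: ae_eq_refl_iff)

lemma ae_eq_rep_abs: "f \<in> borel_measurable unit_leb \<Longrightarrow> ae_eq (rep_L0 (abs_L0 f)) f"
  by (rule Quotient3_rep_abs[OF Quotient3_L0]) (simp add: ae_eq_refl_iff)

lemma AE_rep_abs: "f \<in> borel_measurable unit_leb \<Longrightarrow> AE x in unit_leb. rep_L0 (abs_L0 f) x = f x"
  using ae_eq_rep_abs by (auto simp: ae_eq_def)

lemma AE_rep_plus: "AE x in unit_leb. rep_L0 (u + v) x = rep_L0 u x + rep_L0 v x"
  using AE_rep_abs[of "\<lambda>x. rep_L0 u x + rep_L0 v x"] plus_L0.abs_eq[of "rep_L0 u" "rep_L0 v"]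
  by (simp add: ae_eq_refl_iff)

lemma AE_rep_diff: "AE x in unit_leb. rep_L0 (u - v) x = rep_L0 u x - rep_L0 v x"
  using AE_rep_abs[of "\<lambda>x. rep_L0 u x - rep_L0 v x"] minus_L0.abs_eq[of "rep_L0 u" "rep_L0 v"]
  by (simp add: ae_eq_refl_iff)

lemma AE_rep_scaleR: "AE x in unit_leb. rep_L0 (c *\<^sub>R u) x = c * rep_L0 u x"
  using AE_rep_abs[of "\<lambda>x. c * rep_L0 u x"] scaleR_L0.abs_eq[of "rep_L0 u" c]
  by (simp add: ae_eq_refl_iff)

lemma Lp_iff: "u \<in> Lp p \<longleftrightarrow> integrable unit_leb (\<lambda>x. \<bar>rep_L0 u x\<bar> powr p)"
  by (simp add: Lp_def in_Lp.rep_eq)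

lemma abs_L0_in_Lp_iff:
  "f \<in> borel_measurable unit_leb \<Longrightarrow> abs_L0 f \<in> Lp p \<longleftrightarrow> integrable unit_leb (\<lambda>x. \<bar>f x\<bar> powr p)"
  by (simp add: Lp_def in_Lp.abs_eq ae_eq_refl_iff)

lemma Lp_norm_abs_L0:
  "f \<in> borel_measurable unit_leb \<Longrightarrow>
    Lp_norm p (abs_L0 f) = (\<integral>x. \<bar>f x\<bar> powr p \<partial>unit_leb) powr (1 / p)"
  by (simp add: Lp_norm.abs_eq ae_eq_refl_iff)

lemma Lp_norm_nonneg [simp]: "0 \<le> Lp_norm p u"
  by (simp add: Lp_norm.rep_eq)

lemma Lp_norm_powr: "p \<noteq> 0 \<Longrightarrow> Lp_norm p u powr p = (\<integral>x. \<bar>rep_L0 u x\<bar> powr p \<partial>unit_leb)"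
  by (simp add: Lp_norm.rep_eq powr_powr integral_nonneg_AE)

lemma Lp_zero [simp]: "0 \<in> Lp p"
  unfolding Lp_def by (simp, transfer, simp)

lemma Lp_norm_zero [simp]: "Lp_norm p 0 = 0"
  by transfer simp

lemma Lp_scaleR: "u \<in> Lp p \<Longrightarrow> c *\<^sub>R u \<in> Lp p"
  unfolding Lp_def by (simp, transfer) (simp add: abs_mult powr_mult)

lemma Lp_norm_scaleR: "0 < p \<Longrightarrow> Lp_norm p (c *\<^sub>R u) = \<bar>c\<bar> * Lp_norm p u"
  by transfer (simp add: abs_mult powr_mult powr_powr)

lemma Lp_minus: "u \<in> Lp p \<Longrightarrow> - u \<in> Lp p"
  using Lp_scaleR[of u p "-1"] by simp

lemma Lp_norm_minus [simp]: "Lp_norm p (- u) = Lp_norm p u"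
  by transfer simp

lemma Lp_norm_minus_commute: "Lp_norm p (u - v) = Lp_norm p (v - u)"
  using Lp_norm_minus[of p "v - u"] by simp

lemma Lp_add: "1 \<le> p \<Longrightarrow> u \<in> Lp p \<Longrightarrow> v \<in> Lp p \<Longrightarrow> u + v \<in> Lp p"
  unfolding Lp_def by (simp, transfer) (intro integrable_powr_add, auto simp: ae_eq_refl_iff)

lemma Lp_diff: "1 \<le> p \<Longrightarrow> u \<in> Lp p \<Longrightarrow> v \<in> Lp p \<Longrightarrow> u - v \<in> Lp p"
  using Lp_add[of p u "- v"] Lp_minus by simp

lemma Lp_sum: "1 \<le> p \<Longrightarrow> (\<And>i. i \<in> I \<Longrightarrow> u i \<in> Lp p) \<Longrightarrow> sum u I \<in> Lp p"
  by (induction I rule: infinite_finite_induct) (auto intro: Lp_add)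

lemma Lp_norm_triangle:
  "1 \<le> p \<Longrightarrow> u \<in> Lp p \<Longrightarrow> v \<in> Lp p \<Longrightarrow> Lp_norm p (u + v) \<le> Lp_norm p u + Lp_norm p v"
  unfolding Lp_def by (simp, transfer) (intro minkowski, auto simp: ae_eq_refl_iff)

lemma Lp_norm_eq_0_iff:
  assumes "0 < p" "u \<in> Lp p"
  shows "Lp_norm p u = 0 \<longleftrightarrow> u = 0"
proof
  assume "Lp_norm p u = 0"
  then have "(\<integral>x. \<bar>rep_L0 u x\<bar> powr p \<partial>unit_leb) = 0"
    by (simp add: Lp_norm.rep_eq)
  then have "AE x in unit_leb. \<bar>rep_L0 u x\<bar> powr p = 0"
    using assms by (subst (asm) integral_nonneg_eq_0_iff_AE) (auto simp: Lp_iff)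
  then have "ae_eq (rep_L0 u) (\<lambda>_. 0)"
    by (simp add: ae_eq_def)
  then show "u = 0"
    using abs_L0_eqI by (fastforce simp: zero_L0_def)
qed simp

lemma Lp_bound:
  assumes p: "1 \<le> p" and v: "v \<in> Lp p" and c: "0 \<le> c"
    and le: "AE x in unit_leb. \<bar>rep_L0 u x\<bar> \<le> c * \<bar>rep_L0 v x\<bar>"
  shows "u \<in> Lp p" "Lp_norm p u \<le> c * Lp_norm p v"
proof -
  have le': "AE x in unit_leb. \<bar>rep_L0 u x\<bar> powr p \<le> c powr p * \<bar>rep_L0 v x\<bar> powr p"
    using le
  proof eventually_elim
    case (elim x)
    then have "\<bar>rep_L0 u x\<bar> powr p \<le> (c * \<bar>rep_L0 v x\<bar>) powr p"
      using p by (intro powr_mono2) auto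
    then show ?case
      by (simp add: powr_mult)
  qed
  show u: "u \<in> Lp p"
    unfolding Lp_iff
  proof (rule Bochner_Integration.integrable_bound)
    show "integrable unit_leb (\<lambda>x. c powr p * \<bar>rep_L0 v x\<bar> powr p)"
      using v by (simp add: Lp_iff)
    show "AE x in unit_leb. norm (\<bar>rep_L0 u x\<bar> powr p) \<le> norm (c powr p * \<bar>rep_L0 v x\<bar> powr p)"
      using le' by eventually_elim simp
  qed simp
  have "(\<integral>x. \<bar>rep_L0 u x\<bar> powr p \<partial>unit_leb) \<le> (\<integral>x. c powr p * \<bar>rep_L0 v x\<bar> powr p \<partial>unit_leb)"
    using u v le' by (intro integral_mono_AE) (auto simp: Lp_iff)
  also have "\<dots> = (c * Lp_norm p v) powr p"
    using p c by (simp add: powr_mult Lp_norm_powr)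
  finally show "Lp_norm p u \<le> c * Lp_norm p v"
    unfolding Lp_norm.rep_eq[of p u] using p c
    by (subst powr_inverse_le_iff) (auto intro: integral_nonneg_AE)
qed

text \<open>Jensen's inequality with the constant weight 1, as the interval has length 1.\<close>

lemma integral_abs_le_Lp_norm:
  assumes p: "1 \<le> p" and u: "u \<in> Lp p"
  shows "integrable unit_leb (rep_L0 u)" "(\<integral>x. \<bar>rep_L0 u x\<bar> \<partial>unit_leb) \<le> Lp_norm p u"
proof -
  note j = jensen_powr[where k = "\<lambda>_. 1" and M = unit_leb and p = p]
  show "integrable unit_leb (rep_L0 u)"
    using j(1)[of "rep_L0 u"] p u by (simp add: Lp_iff)
  have "\<bar>\<integral>x. \<bar>rep_L0 u x\<bar> \<partial>unit_leb\<bar> powr p \<le> Lp_norm p u powr p"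
    using j(2)[of "\<lambda>x. \<bar>rep_L0 u x\<bar>"] p u by (simp add: Lp_iff Lp_norm_powr)
  then show "(\<integral>x. \<bar>rep_L0 u x\<bar> \<partial>unit_leb) \<le> Lp_norm p u"
    using p powr_less_mono2[of p "Lp_norm p u" "\<integral>x. \<bar>rep_L0 u x\<bar> \<partial>unit_leb"]
    by (force simp: not_le[symmetric])
qed

text \<open>Riesz-Fischer: a Cauchy sequence in the \<open>p\<close>-norm is Cauchy in the 1-norm,
  hence has a subsequence converging almost everywhere. Fatou's lemma then gives convergence of the
  whole sequence in the \<open>p\<close>-norm.\<close>

lemma Lp_complete:
  fixes X :: "nat \<Rightarrow> L0"
  assumes p: "1 \<le> p" and X: "\<And>n. X n \<in> Lp p"
    and cauchy: "\<And>e. 0 < e \<Longrightarrow> \<exists>N. \<forall>m\<ge>N. \<forall>n\<ge>N. Lp_norm p (X m - X n) < e"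
  obtains l where "l \<in> Lp p" "\<And>e. 0 < e \<Longrightarrow> \<exists>N. \<forall>n\<ge>N. Lp_norm p (X n - l) \<le> e"
proof -
  have L1: "(\<integral>x. norm (rep_L0 (X m) x - rep_L0 (X n) x) \<partial>unit_leb) \<le> Lp_norm p (X m - X n)" for m n
  proof -
    have "(\<integral>x. norm (rep_L0 (X m) x - rep_L0 (X n) x) \<partial>unit_leb) = (\<integral>x. \<bar>rep_L0 (X m - X n) x\<bar> \<partial>unit_leb)"
      using AE_rep_diff[of "X m" "X n"] by (intro integral_cong_AE) auto
    also have "\<dots> \<le> Lp_norm p (X m - X n)"
      using p X by (intro integral_abs_le_Lp_norm Lp_diff) auto
    finally show ?thesis .
  qed
  obtain r :: "nat \<Rightarrow> nat" where r: "strict_mono r"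
    and r_cauchy: "AE x in unit_leb. Cauchy (\<lambda>i. rep_L0 (X (r i)) x)"
  proof (rule cauchy_L1_AE_cauchy_subseq)
    show "integrable unit_leb (rep_L0 (X n))" for n
      using p X by (rule integral_abs_le_Lp_norm)
    show "\<exists>N. \<forall>i\<ge>N. \<forall>j\<ge>N. (\<integral>x. norm (rep_L0 (X i) x - rep_L0 (X j) x) \<partial>unit_leb) < e" if "0 < e" for e
      using cauchy[OF that] L1 by (meson le_less_trans)
  qed blast
  define f where "f = (\<lambda>x. lim (\<lambda>i. rep_L0 (X (r i)) x))"
  have f [measurable]: "f \<in> borel_measurable unit_leb"
    unfolding f_def by (intro borel_measurable_lim_metric) simp
  have lim: "AE x in unit_leb. (\<lambda>i. rep_L0 (X (r i)) x) \<longlonglongrightarrow> f x"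
    using r_cauchy by eventually_elim (simp add: f_def Cauchy_convergent_iff convergent_LIMSEQ_iff)
  define l where "l = abs_L0 f"
  \<comment> \<open>Fatou's lemma is applied with \<open>n\<close> fixed, along the subsequence; the
    shift by \<open>N\<close> puts every index \<open>r (i + N)\<close> beyond
    \<open>N\<close>.\<close>
  have close: "l - X n \<in> Lp p \<and> Lp_norm p (X n - l) \<le> e"
    if N: "\<And>m n. m \<ge> N \<Longrightarrow> n \<ge> N \<Longrightarrow> Lp_norm p (X m - X n) < e" and n: "N \<le> n" for n N e
  proof -
    have "0 \<le> e"
      using N[of N N] Lp_norm_nonneg[of p "X N - X N"] by linarith
    have rN: "N \<le> r (i + N)" for i
      using seq_suble[OF r, of "i + N"] by linarith
    let ?f = "\<lambda>i. rep_L0 (X (r (i + N)) - X n)"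
    have int: "integrable unit_leb (\<lambda>x. \<bar>?f i x\<bar> powr p)" for i
      using p X Lp_diff by (auto simp: Lp_iff[symmetric])
    have le: "(\<integral>x. \<bar>?f i x\<bar> powr p \<partial>unit_leb) \<le> e powr p" for i
    proof -
      have "Lp_norm p (X (r (i + N)) - X n) powr p \<le> e powr p"
        using N[OF rN n, of i] p by (intro powr_mono2) auto
      then show ?thesis
        using p by (simp add: Lp_norm_powr)
    qed
    have "AE x in unit_leb. \<forall>i. ?f i x = rep_L0 (X (r (i + N))) x - rep_L0 (X n) x"
      unfolding AE_all_countable by (intro allI AE_rep_diff)
    then have "AE x in unit_leb. (\<lambda>i. ?f i x) \<longlonglongrightarrow> rep_L0 (l - X n) x"
      using lim AE_rep_diff[of l "X n"] AE_rep_abs[OF f]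
    proof eventually_elim
      case (elim x)
      have "(\<lambda>i. rep_L0 (X (r (i + N))) x - rep_L0 (X n) x) \<longlonglongrightarrow> f x - rep_L0 (X n) x"
        by (intro tendsto_intros LIMSEQ_ignore_initial_segment elim)
      then show ?case
        using elim by (simp add: l_def)
    qed
    note fatou = fatou_powr[OF _ _ int le this]
    have "l - X n \<in> Lp p"
      using fatou(1) p by (simp add: Lp_iff)
    moreover have "Lp_norm p (l - X n) \<le> e"
      unfolding Lp_norm.rep_eq using p \<open>0 \<le> e\<close> fatou(2)
      by (subst powr_inverse_le_iff) (auto intro: integral_nonneg_AE)
    ultimately show ?thesis
      by (simp add: Lp_norm_minus_commute)
  qed
  show thesis
  proof
    obtain N where "\<forall>m\<ge>N. \<forall>n\<ge>N. Lp_norm p (X m - X n) < 1"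
      using cauchy[of 1] by auto
    then have "l - X N \<in> Lp p"
      using close[of N 1 N] by auto
    then show "l \<in> Lp p"
      using Lp_add[OF p _ X, of "l - X N" N] by simp
    show "\<exists>N. \<forall>n\<ge>N. Lp_norm p (X n - l) \<le> e" if "0 < e" for e
      using cauchy[OF that] close[of _ e] by meson
  qed
qed

subsection \<open>Composition with a Lipschitz function\<close>

lemma lipschitz_on_UNIV_measurable:
  fixes \<Phi> :: "real \<Rightarrow> real"
  assumes "K-lipschitz_on UNIV \<Phi>" "f \<in> borel_measurable M"
  shows "(\<lambda>x. \<Phi> (f x)) \<in> borel_measurable M"
  using measurable_compose[OF assms(2) borel_measurable_continuous_onI[OF lipschitz_on_continuous_on[OF assms(1)]]] .

lemma compose_L0_diff_Lp:
  assumes p: "1 \<le> p" and lip: "K-lipschitz_on UNIV \<Phi>" and uv: "u - v \<in> Lp p"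
  shows "compose_L0 \<Phi> u - compose_L0 \<Phi> v \<in> Lp p"
    and "Lp_norm p (compose_L0 \<Phi> u - compose_L0 \<Phi> v) \<le> K * Lp_norm p (u - v)"
proof -
  have K: "0 \<le> K"
    using lip by (rule lipschitz_on_nonneg)
  have "AE x in unit_leb. \<bar>rep_L0 (compose_L0 \<Phi> u - compose_L0 \<Phi> v) x\<bar> \<le> K * \<bar>rep_L0 (u - v) x\<bar>"
    using AE_rep_diff[of "compose_L0 \<Phi> u" "compose_L0 \<Phi> v"] AE_rep_diff[of u v]
      AE_rep_abs[OF lipschitz_on_UNIV_measurable[OF lip borel_measurable_rep_L0], of u]
      AE_rep_abs[OF lipschitz_on_UNIV_measurable[OF lip borel_measurable_rep_L0], of v]
  proof eventually_elim
    case (elim x)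
    then show ?case
      using lipschitz_onD[OF lip, of "rep_L0 u x" "rep_L0 v x"] by (simp add: compose_L0_def dist_real_def)
  qed
  from Lp_bound[OF p uv K this] show "compose_L0 \<Phi> u - compose_L0 \<Phi> v \<in> Lp p"
    "Lp_norm p (compose_L0 \<Phi> u - compose_L0 \<Phi> v) \<le> K * Lp_norm p (u - v)" .
qed

lemma compose_L0_zero:
  assumes "\<Phi> 0 = 0" "K-lipschitz_on UNIV \<Phi>"
  shows "compose_L0 \<Phi> 0 = 0"
proof -
  have "AE x in unit_leb. rep_L0 0 x = 0"
    using AE_rep_abs[of "\<lambda>_. 0"] by (simp add: zero_L0_def)
  then have "ae_eq (\<lambda>x. \<Phi> (rep_L0 0 x)) (\<lambda>_. 0)"
    using assms lipschitz_on_UNIV_measurable[OF assms(2), of "rep_L0 0" unit_leb] by (auto simp: ae_eq_def)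
  then show ?thesis
    unfolding compose_L0_def zero_L0_def by (rule abs_L0_eqI)
qed

text \<open>Comparison with the zero function, which \<open>\<Phi>\<close> fixes.\<close>

lemma compose_L0_in_Lp:
  assumes "1 \<le> p" "\<Phi> 0 = 0" "K-lipschitz_on UNIV \<Phi>" "u \<in> Lp p"
  shows "compose_L0 \<Phi> u \<in> Lp p"
  using compose_L0_diff_Lp(1)[of p K \<Phi> u 0] assms by (simp add: compose_L0_zero)

subsection \<open>The graphon operator\<close>

text \<open>Jensen's inequality in each row, whose mass is at most 1, moves the power inside the
  integral. Tonelli's theorem then exchanges the integrals, and the column bound absorbs the
  kernel.\<close>

lemma schur_test:
  fixes k :: "'a \<Rightarrow> 'a \<Rightarrow> real" and f :: "'a \<Rightarrow> real"
  assumes M: "sigma_finite_measure M" and p: "1 \<le> p"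
    and k_meas: "case_prod k \<in> borel_measurable (M \<Otimes>\<^sub>M M)" and k_nonneg: "\<And>x y. 0 \<le> k x y"
    and rows: "AE x in M. (\<integral>\<^sup>+y. ennreal (k x y) \<partial>M) \<le> 1"
    and cols: "AE y in M. (\<integral>\<^sup>+x. ennreal (k x y) \<partial>M) \<le> 1"
    and [measurable]: "f \<in> borel_measurable M" and f: "integrable M (\<lambda>x. \<bar>f x\<bar> powr p)"
  shows "AE x in M. integrable M (\<lambda>y. k x y * f y)"
    and "integrable M (\<lambda>x. \<bar>\<integral>y. k x y * f y \<partial>M\<bar> powr p)"
    and "(\<integral>x. \<bar>\<integral>y. k x y * f y \<partial>M\<bar> powr p \<partial>M) \<le> (\<integral>x. \<bar>f x\<bar> powr p \<partial>M)"
proof -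
  interpret sigma_finite_measure M by fact
  interpret pair_sigma_finite M M ..
  note k_meas [measurable]
  define C where "C = (\<integral>x. \<bar>f x\<bar> powr p \<partial>M)"
  have "0 \<le> C"
    by (auto simp: C_def intro: integral_nonneg_AE)
  have "(\<integral>\<^sup>+x. \<integral>\<^sup>+y. ennreal (k x y * \<bar>f y\<bar> powr p) \<partial>M \<partial>M)
      = (\<integral>\<^sup>+y. \<integral>\<^sup>+x. ennreal (k x y * \<bar>f y\<bar> powr p) \<partial>M \<partial>M)"
    by (rule Fubini'[symmetric]) measurable
  also have "\<dots> = (\<integral>\<^sup>+y. (\<integral>\<^sup>+x. ennreal (k x y) \<partial>M) * ennreal (\<bar>f y\<bar> powr p) \<partial>M)"
    by (intro nn_integral_cong) (simp add: ennreal_mult k_nonneg nn_integral_multc)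
  also have "\<dots> \<le> (\<integral>\<^sup>+y. ennreal (\<bar>f y\<bar> powr p) \<partial>M)"
  proof (rule nn_integral_mono_AE)
    show "AE y in M. (\<integral>\<^sup>+x. ennreal (k x y) \<partial>M) * ennreal (\<bar>f y\<bar> powr p) \<le> ennreal (\<bar>f y\<bar> powr p)"
      using cols by eventually_elim (metis mult_right_mono mult_1 zero_le)
  qed
  also have "\<dots> = ennreal C"
    using f by (simp add: C_def nn_integral_eq_integral)
  finally have double: "(\<integral>\<^sup>+x. \<integral>\<^sup>+y. ennreal (k x y * \<bar>f y\<bar> powr p) \<partial>M \<partial>M) \<le> ennreal C" .
  \<comment> \<open>Finiteness of the double integral supplies, for almost every row, the
    integrability that \<open>jensen_powr\<close> asks for.\<close>
  then have "AE x in M. (\<integral>\<^sup>+y. ennreal (k x y * \<bar>f y\<bar> powr p) \<partial>M) \<noteq> \<infinity>"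
    by (intro nn_integral_noteq_infinite) (auto simp: top_unique)
  with rows have *: "AE x in M. integrable M (\<lambda>y. k x y * f y) \<and>
    ennreal (\<bar>\<integral>y. k x y * f y \<partial>M\<bar> powr p) \<le> (\<integral>\<^sup>+y. ennreal (k x y * \<bar>f y\<bar> powr p) \<partial>M)"
    using AE_space
  proof eventually_elim
    case (elim x)
    have [measurable]: "k x \<in> borel_measurable M"
      using elim(3) by measurable
    have k: "integrable M (k x)"
      using elim k_nonneg by (intro integrableI_bounded) (auto simp: le_less_trans)
    then have "ennreal (\<integral>y. k x y \<partial>M) \<le> 1"
      using elim k_nonneg by (simp add: nn_integral_eq_integral)
    then have mass: "(\<integral>y. k x y \<partial>M) \<le> 1"
      by simp
    have kf: "integrable M (\<lambda>y. k x y * \<bar>f y\<bar> powr p)"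
      using elim k_nonneg by (intro integrableI_bounded) (auto simp: less_top)
    note jensen = jensen_powr[OF p _ k k_nonneg mass kf]
    show ?case
      using jensen kf k_nonneg by (auto simp: nn_integral_eq_integral intro: ennreal_leI)
  qed
  then show "AE x in M. integrable M (\<lambda>y. k x y * f y)"
    by eventually_elim simp
  have "(\<integral>\<^sup>+x. ennreal (\<bar>\<integral>y. k x y * f y \<partial>M\<bar> powr p) \<partial>M)
      \<le> (\<integral>\<^sup>+x. \<integral>\<^sup>+y. ennreal (k x y * \<bar>f y\<bar> powr p) \<partial>M \<partial>M)"
    using * by (intro nn_integral_mono_AE) auto
  also note double
  finally have le: "(\<integral>\<^sup>+x. ennreal (\<bar>\<integral>y. k x y * f y \<partial>M\<bar> powr p) \<partial>M) \<le> ennreal C" .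
  show int: "integrable M (\<lambda>x. \<bar>\<integral>y. k x y * f y \<partial>M\<bar> powr p)"
    using le by (intro integrableI_bounded) (auto simp: le_less_trans)
  then show "(\<integral>x. \<bar>\<integral>y. k x y * f y \<partial>M\<bar> powr p \<partial>M) \<le> (\<integral>x. \<bar>f x\<bar> powr p \<partial>M)"
    using le \<open>0 \<le> C\<close> by (simp add: nn_integral_eq_integral C_def)
qed

section \<open>Passage between Lebesgue measure on the interval and Borel measure on the
  line\<close>

lemma AE_unit_leb_iff: "(AE x in unit_leb. P x) \<longleftrightarrow> (AE x in lborel. x \<in> {0<..<1} \<longrightarrow> P x)"
  by (simp add: AE_restrict_space_iff AE_completion_iff)

text \<open>Lebesgue measure is complete, so a change on a null set preserves measurability.\<close>

lemma measurable_unit_leb_AE: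
  fixes f g :: "real \<Rightarrow> real"
  assumes "g \<in> borel_measurable unit_leb" "AE x in unit_leb. f x = g x"
  shows "f \<in> borel_measurable unit_leb"
proof -
  have "(\<lambda>x. if x \<in> {0<..<1} then g x else 0) \<in> borel_measurable lebesgue"
    using assms(1) by (intro borel_measurable_if_I) auto
  then have "(\<lambda>x. if x \<in> {0<..<1} then f x else 0) \<in> borel_measurable lebesgue"
    by (rule borel_measurable_AE) (use assms(2) in \<open>auto simp: AE_unit_leb_iff AE_completion_iff\<close>)
  then show ?thesis
    by (rule borel_measurable_if_D)
qed

text \<open>Moves integrals to \<open>lborel\<close>, where the product theorems apply. Since
  \<open>g\<close> vanishes off the interval, integrating over the line changes nothing.\<close>

lemma unit_leb_transfer:
  fixes f g :: "real \<Rightarrow> real"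
  assumes eq: "AE x in unit_leb. f x = g x" and g [measurable]: "g \<in> borel_measurable lborel"
    and outside: "\<And>x. x \<notin> {0<..<1} \<Longrightarrow> g x = 0"
  shows "f \<in> borel_measurable unit_leb"
    and "integrable unit_leb f \<longleftrightarrow> integrable lborel g"
    and "(\<integral>x. f x \<partial>unit_leb) = (\<integral>x. g x \<partial>lborel)"
proof -
  have g': "g \<in> borel_measurable unit_leb"
    using measurable_restrict_space1[OF measurable_completion[OF g]] .
  show f: "f \<in> borel_measurable unit_leb"
    using g' eq by (rule measurable_unit_leb_AE)
  have ind: "(\<lambda>x. indicator {0<..<1} x *\<^sub>R g x) = g"
    using outside by (intro ext) (metis indicator_simps mult_zero_right mult_1 real_scaleR_def)
  have "integrable unit_leb f \<longleftrightarrow> integrable unit_leb g"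
    using f g' eq by (intro integrable_cong_AE)
  also have "\<dots> \<longleftrightarrow> integrable lborel g"
    by (subst integrable_restrict_space) (simp, unfold ind, rule integrable_completion, rule g)
  finally show "integrable unit_leb f \<longleftrightarrow> integrable lborel g" .
  have "(\<integral>x. f x \<partial>unit_leb) = (\<integral>x. g x \<partial>unit_leb)"
    using f g' eq by (intro integral_cong_AE)
  also have "\<dots> = (\<integral>x. g x \<partial>lborel)"
    by (subst integral_restrict_space) (simp, unfold ind, rule integral_completion, rule g)
  finally show "(\<integral>x. f x \<partial>unit_leb) = (\<integral>x. g x \<partial>lborel)" .
qed

lemma unit_leb_borel_representative:
  fixes f :: "real \<Rightarrow> real"
  assumes "f \<in> borel_measurable unit_leb"
  obtains g where "g \<in> borel_measurable lborel" "\<And>x. x \<notin> {0<..<1} \<Longrightarrow> g x = 0"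
    "AE x in unit_leb. f x = g x"
proof -
  have "(\<lambda>x. if x \<in> {0<..<1} then f x else 0) \<in> borel_measurable lebesgue"
    using assms by (intro borel_measurable_if_I) auto
  then obtain g where g [measurable]: "g \<in> borel_measurable lborel"
    and eq: "AE x in lborel. (if x \<in> {0<..<1} then f x else 0) = g x"
    using completion_ex_borel_measurable_real by blast
  show thesis
  proof
    show "(\<lambda>x. if x \<in> {0<..<1} then g x else 0) \<in> borel_measurable lborel"
      by measurable
    show "AE x in unit_leb. f x = (if x \<in> {0<..<1} then g x else 0)"
      unfolding AE_unit_leb_iff using eq by eventually_elim auto
  qed auto
qed

section \<open>The kernel and the operator of a graphon\<close>

locale graphon =
  fixes W :: "real \<Rightarrow> real \<Rightarrow> real"
  assumes W_L1: "integrable (lebesgue_on ({0<..<1} \<times> {0<..<1})) (\<lambda>(x, y). W x y)"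
    and W_sym: "\<And>x y. x \<in> {0<..<1} \<Longrightarrow> y \<in> {0<..<1} \<Longrightarrow> W x y = W y x"
    and W_nonneg: "\<And>x y. x \<in> {0<..<1} \<Longrightarrow> y \<in> {0<..<1} \<Longrightarrow> W x y \<ge> 0"
    and W_deg: "AE x in unit_leb. (\<integral>y. W x y \<partial>unit_leb) \<le> 1"
begin

text \<open>Joint Lebesgue measurability leaves single rows of \<open>W\<close> uncontrolled. The
  kernel \<open>k\<close> is a Borel representative of the extension of \<open>W\<close> by zero; by
  Fubini's theorem almost every row of \<open>W\<close> agrees almost everywhere with that of
  \<open>k\<close>.\<close>

lemma borel_kernel:
  obtains k where "case_prod k \<in> borel_measurable (lborel \<Otimes>\<^sub>M lborel)" "\<And>x y. 0 \<le> k x y"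
    "\<And>x y. y \<notin> {0<..<1} \<Longrightarrow> k x y = 0" "\<And>x y. x \<notin> {0<..<1} \<Longrightarrow> k x y = 0"
    "AE x in lborel. (\<integral>\<^sup>+y. ennreal (k x y) \<partial>lborel) \<le> 1"
    "AE y in lborel. (\<integral>\<^sup>+x. ennreal (k x y) \<partial>lborel) \<le> 1"
    "AE x in unit_leb. AE y in unit_leb. W x y = k x y"
proof -
  let ?S = "{0<..<1::real}" and ?L = "lborel :: real measure"
  define g where "g = (\<lambda>z. if z \<in> ?S \<times> ?S then case z of (x, y) \<Rightarrow> W x y else 0)"
  have S: "?S \<times> ?S \<in> sets lebesgue"
    by (intro sets_completionI_sets) (auto simp: lborel_prod[symmetric])
  have g: "g \<in> borel_measurable lebesgue"
    unfolding g_def using W_L1 S by (intro borel_measurable_if_I) auto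
  have "integrable lebesgue (\<lambda>z. indicator (?S \<times> ?S) z *\<^sub>R (case z of (x, y) \<Rightarrow> W x y))"
    using W_L1 S by (subst (asm) integrable_restrict_space) auto
  then have g_int: "integrable lebesgue g"
    by (rule Bochner_Integration.integrable_cong[THEN iffD1, rotated -1]) (auto simp: g_def)
  obtain g' where g' [measurable]: "g' \<in> borel_measurable lborel" and eq: "AE z in lborel. g z = g' z"
    using completion_ex_borel_measurable_real[OF g] by blast
  \<comment> \<open>The representative \<open>g'\<close> is nonnegative, and zero off the square,
    only almost everywhere; the maximum and the case distinction enforce both at every
    point.\<close>
  define k where "k x y = (if x \<in> ?S \<and> y \<in> ?S then max 0 (g' (x, y)) else 0)" for x y
  have k_nonneg: "0 \<le> k x y" for x y
    by (simp add: k_def)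
  have g'_pair [measurable]: "g' \<in> borel_measurable (?L \<Otimes>\<^sub>M ?L)"
    using g' by (simp add: lborel_prod)
  have k [measurable]: "case_prod k \<in> borel_measurable (?L \<Otimes>\<^sub>M ?L)"
    unfolding k_def by measurable
  have gk: "AE z in ?L \<Otimes>\<^sub>M ?L. g z = case_prod k z"
    unfolding lborel_prod using eq
  proof eventually_elim
    case (elim z)
    show ?case
    proof (cases "z \<in> ?S \<times> ?S")
      case True
      then have "0 \<le> g z"
        using W_nonneg by (auto simp: g_def)
      then show ?thesis
        using True elim by (auto simp: k_def split: prod.splits)
    qed (cases z, auto simp: g_def k_def)
  qed
  then have gk': "AE z in lebesgue. g z = case_prod k z"
    unfolding lborel_prod by (rule AE_completion)
  have k_meas: "case_prod k \<in> borel_measurable (lborel :: (real \<times> real) measure)"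
    using k unfolding lborel_prod .
  have "integrable lebesgue (case_prod k)"
    by (rule integrable_cong_AE_imp[OF g_int]) (rule measurable_completion[OF k_meas], rule gk')
  then have "integrable lborel (case_prod k)"
    by (rule integrable_completion[OF k_meas, THEN iffD1])
  then have "integrable (?L \<Otimes>\<^sub>M ?L) (case_prod k)"
    unfolding lborel_prod .
  \<comment> \<open>A row that is not integrable has Bochner integral 0 by default and would satisfy
    \<open>W_deg\<close> vacuously. Integrability is thus secured before the bound is restated for
    the nonnegative integral.\<close>
  then have k_int: "AE x in ?L. integrable ?L (k x)"
    using lborel_pair.AE_integrable_fst'[of "case_prod k"] by simp
  have gk_row: "AE x in ?L. AE y in ?L. g (x, y) = k x y"
    using lborel_pair.AE_pair[OF gk] by simp
  have W_row: "AE x in unit_leb. AE y in unit_leb. W x y = k x y"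
    unfolding AE_unit_leb_iff using gk_row
    by eventually_elim (auto simp: g_def elim: eventually_mono)
  have rows: "AE x in ?L. (\<integral>\<^sup>+y. ennreal (k x y) \<partial>?L) \<le> 1"
    using W_deg W_row k_int unfolding AE_unit_leb_iff[of "\<lambda>x. _ x \<le> _"] AE_unit_leb_iff[of "\<lambda>x. AE y in _. _ x y"]
  proof eventually_elim
    case (elim x)
    show ?case
    proof (cases "x \<in> ?S")
      case True
      have [measurable]: "k x \<in> borel_measurable lborel"
        using elim(3) by simp
      have "(\<integral>y. W x y \<partial>unit_leb) = (\<integral>y. k x y \<partial>?L)"
        using elim True by (intro unit_leb_transfer) (auto simp: k_def)
      then show ?thesis
        using elim True by (simp add: nn_integral_eq_integral k_nonneg)
    next
      case False
      then have "k x y = 0" for y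
        by (auto simp: k_def)
      then show ?thesis
        by simp
    qed
  qed
  \<comment> \<open>\<open>k\<close> inherits the symmetry of \<open>W\<close> only almost
    everywhere in the plane: exchanging the coordinates preserves the product measure, hence also
    its null sets.\<close>
  have swap: "AE z in ?L \<Otimes>\<^sub>M ?L. g (case z of (x, y) \<Rightarrow> (y, x)) = case_prod k (case z of (x, y) \<Rightarrow> (y, x))"
    using gk by (subst (asm) lborel_pair.distr_pair_swap) (rule AE_distrD, measurable)
  have "AE z in ?L \<Otimes>\<^sub>M ?L. case_prod k z = case_prod k (case z of (x, y) \<Rightarrow> (y, x))"
    using gk swap by eventually_elim (use W_sym in \<open>auto simp: g_def split: if_splits\<close>)
  then have "AE y in ?L. AE x in ?L. k y x = k x y"
    using lborel_pair.AE_pair by fastforce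
  then have cols: "AE y in ?L. (\<integral>\<^sup>+x. ennreal (k x y) \<partial>?L) \<le> 1"
    using rows
  proof eventually_elim
    case (elim y)
    have "(\<integral>\<^sup>+x. ennreal (k x y) \<partial>?L) = (\<integral>\<^sup>+x. ennreal (k y x) \<partial>?L)"
      using elim(1) by (intro nn_integral_cong_AE) auto
    then show ?case
      using elim(2) by simp
  qed
  show thesis
    by (rule that[OF k _ _ _ rows cols W_row]) (auto simp: k_def)
qed

definition graphon_fun :: "(real \<Rightarrow> real) \<Rightarrow> real \<Rightarrow> real" where
  "graphon_fun f x = (\<integral>y. W x y * (f y - f x) \<partial>unit_leb)"

lemma graphon_op_eq: "graphon_op W u = abs_L0 (graphon_fun (rep_L0 u))"
  by (simp add: graphon_op_def graphon_fun_def[abs_def])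

text \<open>\<open>a\<close> is the integral operator with kernel \<open>W\<close>, bounded by
  Schur's test, and \<open>b\<close> is the product of \<open>u\<close> with the degree function,
  which is at most 1. Agreement almost everywhere with a measurable expression gives the
  measurability without which \<open>abs_L0\<close> would be meaningless.\<close>

lemma graphon_op_decomposition:
  assumes p: "1 \<le> p" and u: "u \<in> Lp p"
  shows "graphon_fun (rep_L0 u) \<in> borel_measurable unit_leb"
    and "AE x in unit_leb. integrable unit_leb (W x) \<and> integrable unit_leb (\<lambda>y. W x y * rep_L0 u y)"
    and "\<exists>a\<in>Lp p. \<exists>b\<in>Lp p. graphon_op W u = a - b \<and>
      Lp_norm p a \<le> Lp_norm p u \<and> Lp_norm p b \<le> Lp_norm p u"
proof -
  obtain k where k [measurable]: "case_prod k \<in> borel_measurable (lborel \<Otimes>\<^sub>M lborel)"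
    and k_nonneg: "\<And>x y. 0 \<le> k x y"
    and k_out: "\<And>x y. y \<notin> {0<..<1} \<Longrightarrow> k x y = 0" "\<And>x y. x \<notin> {0<..<1} \<Longrightarrow> k x y = 0"
    and rows: "AE x in lborel. (\<integral>\<^sup>+y. ennreal (k x y) \<partial>lborel) \<le> 1"
    and cols: "AE y in lborel. (\<integral>\<^sup>+x. ennreal (k x y) \<partial>lborel) \<le> 1"
    and Wk: "AE x in unit_leb. AE y in unit_leb. W x y = k x y"
    by (rule borel_kernel) blast
  obtain f where f [measurable]: "f \<in> borel_measurable lborel"
    and f_out: "\<And>x. x \<notin> {0<..<1} \<Longrightarrow> f x = 0" and uf: "AE x in unit_leb. rep_L0 u x = f x"
    using unit_leb_borel_representative[OF borel_measurable_rep_L0] by blast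
  have kx [measurable]: "k x \<in> borel_measurable lborel" for x
    by measurable
  have f_int: "integrable lborel (\<lambda>x. \<bar>f x\<bar> powr p)"
    and f_norm: "(\<integral>x. \<bar>rep_L0 u x\<bar> powr p \<partial>unit_leb) = (\<integral>x. \<bar>f x\<bar> powr p \<partial>lborel)"
  proof -
    have "AE x in unit_leb. \<bar>rep_L0 u x\<bar> powr p = \<bar>f x\<bar> powr p"
      using uf by eventually_elim simp
    note t = unit_leb_transfer[OF this]
    show "integrable lborel (\<lambda>x. \<bar>f x\<bar> powr p)"
      using t(2) f_out u by (simp add: Lp_iff)
    show "(\<integral>x. \<bar>rep_L0 u x\<bar> powr p \<partial>unit_leb) = (\<integral>x. \<bar>f x\<bar> powr p \<partial>lborel)"
      using t(3) f_out by simp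
  qed
  note schur = schur_test[OF lborel.sigma_finite_measure_axioms p k k_nonneg rows cols f f_int]
  \<comment> \<open>\<open>A\<close> is the integral operator applied to the Borel representative of
    \<open>u\<close>; \<open>D\<close> is the degree function.\<close>
  define A where "A x = (\<integral>y. k x y * f y \<partial>lborel)" for x
  define D where "D x = (\<integral>y. k x y \<partial>lborel)" for x
  have A [measurable]: "A \<in> borel_measurable lborel" and D [measurable]: "D \<in> borel_measurable lborel"
    unfolding A_def D_def by measurable
  have to_leb: "h \<in> borel_measurable unit_leb" if "h \<in> borel_measurable lborel" for h :: "real \<Rightarrow> real"
    using measurable_restrict_space1[OF measurable_completion[OF that]] .
  have row: "AE x in unit_leb. integrable unit_leb (W x) \<and> integrable unit_leb (\<lambda>y. W x y * rep_L0 u y)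
    \<and> graphon_fun (rep_L0 u) x = A x - D x * rep_L0 u x"
  proof -
    have "AE x in unit_leb. integrable lborel (\<lambda>y. k x y * f y)"
      using schur(1) unfolding AE_unit_leb_iff by eventually_elim simp
    moreover have "AE x in unit_leb. (\<integral>\<^sup>+y. ennreal (k x y) \<partial>lborel) \<le> 1"
      using rows unfolding AE_unit_leb_iff by eventually_elim simp
    ultimately show ?thesis
      using Wk
    proof eventually_elim
      case (elim x)
      have "integrable lborel (k x)"
        using elim(2) k_nonneg by (intro integrableI_bounded) (auto simp: le_less_trans)
      note W = unit_leb_transfer[OF elim(3) kx k_out(1)]
      have "AE y in unit_leb. W x y * rep_L0 u y = k x y * f y"
        using elim(3) uf by eventually_elim simp
      note Wu = unit_leb_transfer[OF this]
      have Wx: "integrable unit_leb (W x)"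
        using W(2) \<open>integrable lborel (k x)\<close> by simp
      have Wux: "integrable unit_leb (\<lambda>y. W x y * rep_L0 u y)"
        using Wu(2) elim(1) k_out(1) by simp
      have "graphon_fun (rep_L0 u) x = (\<integral>y. W x y * rep_L0 u y \<partial>unit_leb) - (\<integral>y. W x y \<partial>unit_leb) * rep_L0 u x"
        using Wx Wux unfolding graphon_fun_def right_diff_distrib
        by (subst Bochner_Integration.integral_diff) auto
      also have "\<dots> = A x - D x * rep_L0 u x"
        using W(3) Wu(3) k_out(1) by (simp add: A_def D_def)
      finally show ?case
        using Wx Wux by simp
    qed
  qed
  then show "AE x in unit_leb. integrable unit_leb (W x) \<and> integrable unit_leb (\<lambda>y. W x y * rep_L0 u y)"
    by eventually_elim simp
  have A' [measurable]: "A \<in> borel_measurable unit_leb" and D' [measurable]: "D \<in> borel_measurable unit_leb"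
    by (auto intro: to_leb)
  have eq: "AE x in unit_leb. graphon_fun (rep_L0 u) x = A x - D x * rep_L0 u x"
    using row by eventually_elim simp
  show meas: "graphon_fun (rep_L0 u) \<in> borel_measurable unit_leb"
    by (rule measurable_unit_leb_AE[OF _ eq]) measurable
  let ?a = "abs_L0 A" and ?b = "abs_L0 (\<lambda>x. D x * rep_L0 u x)"
  have "graphon_op W u = abs_L0 (\<lambda>x. A x - D x * rep_L0 u x)"
    unfolding graphon_op_eq using meas eq by (intro abs_L0_eqI) (auto simp: ae_eq_def)
  also have "\<dots> = ?a - ?b"
    by (rule minus_L0.abs_eq[symmetric]) (auto simp: ae_eq_refl_iff)
  finally have split: "graphon_op W u = ?a - ?b" .
  have a_int: "integrable unit_leb (\<lambda>x. \<bar>A x\<bar> powr p)"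
    and a_norm: "(\<integral>x. \<bar>A x\<bar> powr p \<partial>unit_leb) \<le> (\<integral>x. \<bar>rep_L0 u x\<bar> powr p \<partial>unit_leb)"
  proof -
    note t = unit_leb_transfer[where f = "\<lambda>x. \<bar>A x\<bar> powr p" and g = "\<lambda>x. \<bar>A x\<bar> powr p"]
    have "A x = 0" if "x \<notin> {0<..<1}" for x
      using k_out(2)[OF that] by (simp add: A_def)
    then show "integrable unit_leb (\<lambda>x. \<bar>A x\<bar> powr p)"
      "(\<integral>x. \<bar>A x\<bar> powr p \<partial>unit_leb) \<le> (\<integral>x. \<bar>rep_L0 u x\<bar> powr p \<partial>unit_leb)"
      using t schur(2,3) f_norm unfolding A_def[symmetric] by auto
  qed
  have a: "?a \<in> Lp p" "Lp_norm p ?a \<le> Lp_norm p u"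
    using a_int a_norm p by (auto simp: abs_L0_in_Lp_iff Lp_norm_abs_L0 Lp_norm.rep_eq[of p u]
        intro!: powr_mono2 integral_nonneg_AE)
  have "AE x in unit_leb. \<bar>D x\<bar> \<le> 1"
    using rows unfolding AE_unit_leb_iff
  proof eventually_elim
    case (elim x)
    have "integrable lborel (k x)"
      using elim k_nonneg by (intro integrableI_bounded) (auto simp: le_less_trans)
    then have "ennreal (D x) \<le> 1"
      using elim k_nonneg by (simp add: D_def nn_integral_eq_integral)
    moreover have "0 \<le> D x"
      unfolding D_def using k_nonneg by (intro integral_nonneg_AE) auto
    ultimately show ?case
      by simp
  qed
  moreover have "AE x in unit_leb. rep_L0 ?b x = D x * rep_L0 u x"
    by (intro AE_rep_abs) measurable
  ultimately have "AE x in unit_leb. \<bar>rep_L0 ?b x\<bar> \<le> 1 * \<bar>rep_L0 u x\<bar>"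
    by eventually_elim (simp add: abs_mult mult_left_le_one_le)
  note b = Lp_bound[OF p u zero_le_one this]
  show "\<exists>a\<in>Lp p. \<exists>b\<in>Lp p. graphon_op W u = a - b \<and>
      Lp_norm p a \<le> Lp_norm p u \<and> Lp_norm p b \<le> Lp_norm p u"
    using split a b by (intro bexI[of _ ?a] bexI[of _ ?b]) auto
qed

lemma graphon_op_Lp: "1 \<le> p \<Longrightarrow> u \<in> Lp p \<Longrightarrow> graphon_op W u \<in> Lp p"
  using graphon_op_decomposition(3) Lp_diff by metis

text \<open>The factor 2 adds the bound 1 for the integral operator and the bound 1 for
  multiplication by the degree.\<close>

lemma graphon_op_norm:
  assumes p: "1 \<le> p" and u: "u \<in> Lp p"
  shows "Lp_norm p (graphon_op W u) \<le> 2 * Lp_norm p u"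
proof -
  obtain a b where "a \<in> Lp p" "b \<in> Lp p" "graphon_op W u = a - b"
    "Lp_norm p a \<le> Lp_norm p u" "Lp_norm p b \<le> Lp_norm p u"
    using graphon_op_decomposition(3)[OF p u] by blast
  then show ?thesis
    using Lp_norm_triangle[OF p, of a "- b"] Lp_minus[of b p] by simp
qed

text \<open>\<open>rep_L0\<close> is additive only almost everywhere, and this matters twice: in the
  integration variable \<open>y\<close> and at the point \<open>x\<close> of evaluation. Row
  integrability allows the integral to be split.\<close>

lemma graphon_op_add:
  assumes p: "1 \<le> p" and u: "u \<in> Lp p" and v: "v \<in> Lp p"
  shows "graphon_op W (u + v) = graphon_op W u + graphon_op W v"
proof -
  note uv = Lp_add[OF p u v]
  note [measurable] = graphon_op_decomposition(1)[OF p u] graphon_op_decomposition(1)[OF p v]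
    graphon_op_decomposition(1)[OF p uv]
  have "AE x in unit_leb. graphon_fun (rep_L0 (u + v)) x = graphon_fun (rep_L0 u) x + graphon_fun (rep_L0 v) x"
    using graphon_op_decomposition(2)[OF p u] graphon_op_decomposition(2)[OF p v]
      graphon_op_decomposition(2)[OF p uv] AE_rep_plus[of u v]
  proof eventually_elim
    case (elim x)
    have [measurable]: "W x \<in> borel_measurable unit_leb"
      using elim by auto
    have "graphon_fun (rep_L0 (u + v)) x
      = (\<integral>y. W x y * (rep_L0 u y - rep_L0 u x) + W x y * (rep_L0 v y - rep_L0 v x) \<partial>unit_leb)"
      unfolding graphon_fun_def
    proof (rule integral_cong_AE)
      show "AE y in unit_leb. W x y * (rep_L0 (u + v) y - rep_L0 (u + v) x)
          = W x y * (rep_L0 u y - rep_L0 u x) + W x y * (rep_L0 v y - rep_L0 v x)"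
        using AE_rep_plus[of u v] by eventually_elim (simp add: elim algebra_simps)
    qed measurable
    also have "\<dots> = graphon_fun (rep_L0 u) x + graphon_fun (rep_L0 v) x"
      unfolding graphon_fun_def using elim
      by (intro Bochner_Integration.integral_add) (auto simp: right_diff_distrib)
    finally show ?case .
  qed
  then have "graphon_op W (u + v) = abs_L0 (\<lambda>x. graphon_fun (rep_L0 u) x + graphon_fun (rep_L0 v) x)"
    unfolding graphon_op_eq by (intro abs_L0_eqI) (simp add: ae_eq_def)
  then show ?thesis
    unfolding graphon_op_eq by (simp add: plus_L0.abs_eq ae_eq_refl_iff)
qed

lemma graphon_op_scaleR:
  assumes p: "1 \<le> p" and u: "u \<in> Lp p"
  shows "graphon_op W (c *\<^sub>R u) = c *\<^sub>R graphon_op W u"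
proof -
  note cu = Lp_scaleR[OF u, of c]
  note [measurable] = graphon_op_decomposition(1)[OF p u] graphon_op_decomposition(1)[OF p cu]
  have "AE x in unit_leb. graphon_fun (rep_L0 (c *\<^sub>R u)) x = c * graphon_fun (rep_L0 u) x"
    using graphon_op_decomposition(2)[OF p u] AE_rep_scaleR[of c u]
  proof eventually_elim
    case (elim x)
    have [measurable]: "W x \<in> borel_measurable unit_leb"
      using elim by auto
    have "graphon_fun (rep_L0 (c *\<^sub>R u)) x = (\<integral>y. c * (W x y * (rep_L0 u y - rep_L0 u x)) \<partial>unit_leb)"
      unfolding graphon_fun_def
    proof (rule integral_cong_AE)
      show "AE y in unit_leb. W x y * (rep_L0 (c *\<^sub>R u) y - rep_L0 (c *\<^sub>R u) x)
          = c * (W x y * (rep_L0 u y - rep_L0 u x))"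
        using AE_rep_scaleR[of c u] by eventually_elim (simp add: elim algebra_simps)
    qed measurable
    then show ?case
      by (simp add: graphon_fun_def)
  qed
  then have "graphon_op W (c *\<^sub>R u) = abs_L0 (\<lambda>x. c * graphon_fun (rep_L0 u) x)"
    unfolding graphon_op_eq by (intro abs_L0_eqI) (simp add: ae_eq_def)
  then show ?thesis
    unfolding graphon_op_eq by (simp add: scaleR_L0.abs_eq ae_eq_refl_iff)
qed

end

subsection \<open>The Banach algebra of bounded operators\<close>

text \<open>
  The type of bounded operators is copied because \<open>'a \<Rightarrow>\<^sub>L 'b\<close> can be made an algebra only for
  \<open>'a = 'b\<close>, which an instance declaration cannot express.
\<close>

typedef (overloaded) 'a endo = "UNIV :: ('a::real_normed_vector \<Rightarrow>\<^sub>L 'a) set"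
  morphisms blinfun_of_endo endo_of_blinfun
  by auto

setup_lifting type_definition_endo

instantiation endo :: (real_normed_vector) real_vector
begin

lift_definition zero_endo :: "'a endo" is 0 .
lift_definition plus_endo :: "'a endo \<Rightarrow> 'a endo \<Rightarrow> 'a endo" is "(+)" .
lift_definition minus_endo :: "'a endo \<Rightarrow> 'a endo \<Rightarrow> 'a endo" is "(-)" .
lift_definition uminus_endo :: "'a endo \<Rightarrow> 'a endo" is uminus .
lift_definition scaleR_endo :: "real \<Rightarrow> 'a endo \<Rightarrow> 'a endo" is "(*\<^sub>R)" .

instance
  by standard (transfer; simp add: algebra_simps)+

end

instantiation endo :: (real_normed_vector) real_normed_vector
begin

lift_definition norm_endo :: "'a endo \<Rightarrow> real" is norm .

definition dist_endo :: "'a endo \<Rightarrow> 'a endo \<Rightarrow> real" where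
  "dist_endo x y = norm (x - y)"

definition sgn_endo :: "'a endo \<Rightarrow> 'a endo" where
  "sgn_endo x = x /\<^sub>R norm x"

definition uniformity_endo :: "('a endo \<times> 'a endo) filter" where
  "uniformity_endo = (INF e\<in>{0<..}. principal {(x, y). dist x y < e})"

definition open_endo :: "'a endo set \<Rightarrow> bool" where
  "open_endo U = (\<forall>x\<in>U. eventually (\<lambda>(x', y). x' = x \<longrightarrow> y \<in> U) uniformity)"

instance
proof
  fix x y :: "'a endo" and a :: real
  show "norm x = 0 \<longleftrightarrow> x = 0"
    by transfer simp
  show "norm (x + y) \<le> norm x + norm y"
    by transfer (rule norm_triangle_ineq)
  show "norm (a *\<^sub>R x) = \<bar>a\<bar> * norm x"
    by transfer simp
qed (rule dist_endo_def sgn_endo_def uniformity_endo_def open_endo_def)+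

end

instantiation endo :: (real_normed_vector) real_normed_algebra
begin

lift_definition times_endo :: "'a endo \<Rightarrow> 'a endo \<Rightarrow> 'a endo" is "(o\<^sub>L)" .

instance
proof
  fix x y z :: "'a endo" and a :: real
  show "x * y * z = x * (y * z)"
    by transfer (rule blinfun_eqI, simp)
  show "(x + y) * z = x * z + y * z"
    by transfer (rule blinfun_eqI, simp add: blinfun.bilinear_simps)
  show "x * (y + z) = x * y + x * z"
    by transfer (rule blinfun_eqI, simp add: blinfun.bilinear_simps)
  show "a *\<^sub>R x * y = a *\<^sub>R (x * y)"
    by transfer (rule blinfun_eqI, simp add: blinfun.bilinear_simps)
  show "x * a *\<^sub>R y = a *\<^sub>R (x * y)"
    by transfer (rule blinfun_eqI, simp add: blinfun.bilinear_simps)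
  show "norm (x * y) \<le> norm x * norm y"
    by transfer (rule norm_blinfun_compose)
qed

end

text \<open>The sort \<open>perfect_space\<close> excludes the zero space, on which the identity has
  norm 0.\<close>

instantiation endo :: ("{real_normed_vector, perfect_space}") real_normed_algebra_1
begin

lift_definition one_endo :: "'a endo" is id_blinfun .

instance
proof
  fix x :: "'a endo"
  show "1 * x = x" "x * 1 = x"
    by (transfer; rule blinfun_eqI; simp)+
  show "norm (1 :: 'a endo) = 1"
    by transfer (rule norm_blinfun_id)
  then show "(0 :: 'a endo) \<noteq> 1"
    by (metis norm_zero zero_neq_one)
qed

end

instance endo :: (banach) banach
proof
  fix X :: "nat \<Rightarrow> 'a endo"
  assume "Cauchy X"
  then have "Cauchy (\<lambda>n. blinfun_of_endo (X n))"
    by (simp add: Cauchy_def dist_norm norm_endo.rep_eq minus_endo.rep_eq)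
  then obtain l where "(\<lambda>n. blinfun_of_endo (X n)) \<longlonglongrightarrow> l"
    by (auto simp: Cauchy_convergent_iff convergent_def)
  then have "X \<longlonglongrightarrow> endo_of_blinfun l"
    by (simp add: tendsto_iff dist_norm norm_endo.rep_eq minus_endo.rep_eq endo_of_blinfun_inverse)
  then show "convergent X"
    by (rule convergentI)
qed

lift_definition endo_apply :: "'a::real_normed_vector endo \<Rightarrow> 'a \<Rightarrow> 'a" is blinfun_apply .

lemma bounded_bilinear_endo_apply: "bounded_bilinear endo_apply"
proof
  fix X Y :: "'a endo" and x y :: 'a and r :: real
  show "endo_apply (X + Y) x = endo_apply X x + endo_apply Y x"
    "endo_apply X (x + y) = endo_apply X x + endo_apply X y"
    "endo_apply (r *\<^sub>R X) x = r *\<^sub>R endo_apply X x"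
    "endo_apply X (r *\<^sub>R x) = r *\<^sub>R endo_apply X x"
    by (transfer; simp add: blinfun.bilinear_simps)+
  have "norm (endo_apply X x) \<le> norm X * norm x * 1" for X :: "'a endo" and x
    by transfer (simp add: norm_blinfun)
  then show "\<exists>K. \<forall>(X :: 'a endo) x. norm (endo_apply X x) \<le> norm X * norm x * K"
    by blast
qed

interpretation endo: bounded_bilinear endo_apply
  by (rule bounded_bilinear_endo_apply)

lemma endo_apply_times [simp]: "endo_apply (X * Y) x = endo_apply X (endo_apply Y x)"
  by transfer simp

lemma endo_apply_one [simp]: "endo_apply 1 x = x"
  by transfer simp

lemma norm_endo_apply: "norm (endo_apply X x) \<le> norm X * norm x"
  by transfer (rule norm_blinfun)

lemma endo_of_bounded_linear:
  assumes "bounded_linear f"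
  obtains X where "\<And>x. endo_apply X x = f x"
  using that[of "endo_of_blinfun (Blinfun f)"] assms
  by (simp add: endo_apply.rep_eq endo_of_blinfun_inverse bounded_linear_Blinfun_apply)

subsection \<open>Exponentials of bounded operators\<close>

lemma continuous_on_exp_endo:
  fixes X :: "'a::{banach, perfect_space} endo"
  shows "continuous_on S (\<lambda>t. exp (t *\<^sub>R X))"
  unfolding continuous_on_eq_continuous_within
  by (intro ballI has_vector_derivative_continuous[OF exp_scaleR_has_vector_derivative_right])

text \<open>In the product rule the derivative of the exponential cancels the linear part of the
  derivative of \<open>w\<close>. With \<open>n = 0\<close> this yields invariance of subspaces and
  uniqueness of the semigroup, and with the nonlinear term the mild formulation.\<close>

lemma exp_endo_variation_of_constants:
  fixes X :: "'a::{banach, perfect_space} endo"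
  assumes "(w has_vector_derivative endo_apply X (w s) + n) (at s within S)"
  shows "((\<lambda>s. endo_apply (exp ((t - s) *\<^sub>R X)) (w s)) has_vector_derivative
    endo_apply (exp ((t - s) *\<^sub>R X)) n) (at s within S)"
proof -
  have "((\<lambda>s. exp (s *\<^sub>R X)) \<circ> (\<lambda>s. t - s) has_vector_derivative (-1) *\<^sub>R (exp ((t - s) *\<^sub>R X) * X)) (at s within S)"
    by (rule vector_diff_chain_within)
      (auto intro!: derivative_eq_intros exp_scaleR_has_vector_derivative_right)
  then have "((\<lambda>s. exp ((t - s) *\<^sub>R X)) has_vector_derivative - (exp ((t - s) *\<^sub>R X) * X)) (at s within S)"
    by (simp add: o_def)
  from endo.has_vector_derivative[OF this assms] show ?thesis
    by (simp add: endo.add_right endo.minus_left)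
qed

lemma exp_endo_add:
  fixes X :: "'a::{banach, perfect_space} endo"
  shows "endo_apply (exp ((s + t) *\<^sub>R X)) x = endo_apply (exp (s *\<^sub>R X)) (endo_apply (exp (t *\<^sub>R X)) x)"
  by (simp add: scaleR_add_left exp_add_commuting flip: endo_apply_times)

text \<open>The curve \<open>?w\<close> satisfies the linear equation with generator
  \<open>X\<close>, so transporting \<open>?w s\<close> to time \<open>t\<close> by the exponential
  gives a value independent of \<open>s\<close>; \<open>s = 0\<close> and \<open>s = t\<close> are
  compared.\<close>

lemma exp_endo_invariant:
  fixes X :: "'a::{banach, perfect_space} endo"
  assumes P: "bounded_linear P" and PX: "\<And>x. P (endo_apply X x) = endo_apply X (P x)"
  shows "P (endo_apply (exp (t *\<^sub>R X)) x) = endo_apply (exp (t *\<^sub>R X)) (P x)"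
proof -
  interpret P: bounded_linear P by fact
  let ?w = "\<lambda>s. P (endo_apply (exp (s *\<^sub>R X)) x)"
  have "(?w has_vector_derivative endo_apply X (?w s) + 0) (at s within S)" for s S
  proof -
    have "((\<lambda>s. exp (s *\<^sub>R X)) has_vector_derivative X * exp (s *\<^sub>R X)) (at s within S)"
      by (rule has_vector_derivative_at_within[OF exp_scaleR_has_vector_derivative_left])
    then have "((\<lambda>s. endo_apply (exp (s *\<^sub>R X)) x) has_vector_derivative endo_apply X (endo_apply (exp (s *\<^sub>R X)) x)) (at s within S)"
      using endo.has_vector_derivative[OF _ has_vector_derivative_const[of x]]
      by (fastforce simp: endo.zero_right)
    from P.has_vector_derivative[OF this] show ?thesis
      by (simp add: PX)
  qed
  from exp_endo_variation_of_constants[OF this]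
  have "((\<lambda>s. endo_apply (exp ((t - s) *\<^sub>R X)) (?w s)) has_vector_derivative 0) (at s within UNIV)" for s
    by (simp add: endo.zero_right)
  then obtain c where "\<And>s. endo_apply (exp ((t - s) *\<^sub>R X)) (?w s) = c"
    using has_vector_derivative_zero_constant[of UNIV] by auto
  from this[of 0] this[of t] show ?thesis
    by simp
qed

subsection \<open>Uniqueness of the semigroup with a given bounded generator\<close>

text \<open>Bridges \<open>Lp_has_derivative\<close> and \<open>is_generator\<close>, which use
  difference quotients, and the linear approximation behind
  \<open>has_vector_derivative\<close>.\<close>

lemma has_vector_derivative_iff_quotient:
  "(f has_vector_derivative D) (at t within S) \<longleftrightarrow>
    ((\<lambda>s. (1 / (s - t)) *\<^sub>R (f s - f t)) \<longlongrightarrow> D) (at t within S)"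
proof -
  have "(f has_vector_derivative D) (at t within S) \<longleftrightarrow>
      ((\<lambda>s. norm ((f s - f t) - (s - t) *\<^sub>R D) / norm (s - t)) \<longlongrightarrow> 0) (at t within S)"
    by (simp add: has_vector_derivative_def has_derivative_iff_norm bounded_linear_scaleR_left)
  also have "\<dots> \<longleftrightarrow> ((\<lambda>s. norm ((1 / (s - t)) *\<^sub>R (f s - f t) - D)) \<longlongrightarrow> 0) (at t within S)"
  proof (rule filterlim_cong[OF refl refl])
    have "norm ((f s - f t) - (s - t) *\<^sub>R D) / norm (s - t) = norm ((1 / (s - t)) *\<^sub>R (f s - f t) - D)"
      if "s \<noteq> t" for s
    proof -
      have "(1 / (s - t)) *\<^sub>R (f s - f t) - D = (1 / (s - t)) *\<^sub>R ((f s - f t) - (s - t) *\<^sub>R D)"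
        using that by (simp add: scaleR_diff_right[of "1 / (s - t)"])
      then show ?thesis
        by simp
    qed
    then show "\<forall>\<^sub>F s in at t within S. norm ((f s - f t) - (s - t) *\<^sub>R D) / norm (s - t)
        = norm ((1 / (s - t)) *\<^sub>R (f s - f t) - D)"
      by (simp add: eventually_at_filter)
  qed
  also have "\<dots> \<longleftrightarrow> ((\<lambda>s. (1 / (s - t)) *\<^sub>R (f s - f t)) \<longlongrightarrow> D) (at t within S)"
    by (simp add: tendsto_norm_zero_iff LIM_zero_iff)
  finally show ?thesis .
qed

text \<open>\<open>\<eta> h\<close> stands for a bound on the operator norm of
  \<open>V h - id\<close>, so that its convergence expresses uniform continuity.\<close>

locale bounded_operator_semigroup =
  fixes V :: "real \<Rightarrow> 'a::{banach, perfect_space} \<Rightarrow> 'a" and \<eta> :: "real \<Rightarrow> real" and X :: "'a endo"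
  assumes bounded_linear_V: "\<And>s. 0 \<le> s \<Longrightarrow> bounded_linear (V s)"
    and V_0 [simp]: "\<And>x. V 0 x = x"
    and V_add: "\<And>s t x. 0 \<le> s \<Longrightarrow> 0 \<le> t \<Longrightarrow> V (s + t) x = V s (V t x)"
    and V_near_id: "\<And>h x. 0 < h \<Longrightarrow> norm (V h x - x) \<le> \<eta> h * norm x"
    and \<eta>_tendsto: "(\<eta> \<longlongrightarrow> 0) (at_right 0)"
    and generator: "\<And>x. ((\<lambda>h. (1 / h) *\<^sub>R (V h x - x)) \<longlongrightarrow> endo_apply X x) (at_right 0)"
begin

lemma V_commute:
  assumes "0 \<le> s" "0 \<le> t"
  shows "V s (V t x) = V t (V s x)"
  using V_add[of s t x] V_add[of t s x] assms by (simp add: add.commute)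

lemma generator_commute:
  assumes "0 \<le> s"
  shows "endo_apply X (V s x) = V s (endo_apply X x)"
proof (rule tendsto_unique)
  interpret V: bounded_linear "V s"
    using assms by (rule bounded_linear_V)
  show "((\<lambda>h. (1 / h) *\<^sub>R (V h (V s x) - V s x)) \<longlongrightarrow> endo_apply X (V s x)) (at_right 0)"
    by (rule generator)
  have "((\<lambda>h. V s ((1 / h) *\<^sub>R (V h x - x))) \<longlongrightarrow> V s (endo_apply X x)) (at_right 0)"
    by (intro V.tendsto generator)
  then show "((\<lambda>h. (1 / h) *\<^sub>R (V h (V s x) - V s x)) \<longlongrightarrow> V s (endo_apply X x)) (at_right 0)"
    by (rule Lim_transform_eventually)
      (use assms in \<open>auto simp: eventually_at_filter V.diff V.scaleR V_commute[of s]\<close>)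
qed simp

lemma right_derivative:
  assumes "0 \<le> s"
  shows "((\<lambda>r. (1 / (r - s)) *\<^sub>R (V r x - V s x)) \<longlongrightarrow> endo_apply X (V s x)) (at_right s)"
proof -
  have "((\<lambda>h. (1 / (h + s - s)) *\<^sub>R (V (h + s) x - V s x)) \<longlongrightarrow> endo_apply X (V s x)) (at_right 0)"
    by (rule Lim_transform_eventually[OF generator])
      (use assms in \<open>auto simp: eventually_at_filter V_add\<close>)
  then show ?thesis
    unfolding at_right_to_0[of s] by (simp add: filterlim_filtermap)
qed

text \<open>The quotient from the left is \<open>V (s - h)\<close> applied to the quotient
  \<open>?q h\<close> at time 0. It converges because the operators \<open>V (s - h)\<close> stay
  bounded for small \<open>h\<close> and \<open>V (s - h) y\<close> tends to \<open>V s y\<close>;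
  both facts use \<open>\<eta>\<close>.\<close>

lemma left_derivative:
  assumes "0 < s"
  shows "((\<lambda>r. (1 / (r - s)) *\<^sub>R (V r x - V s x)) \<longlongrightarrow> endo_apply X (V s x)) (at_left s)"
proof -
  obtain C where C: "\<And>x. norm (V s x) \<le> C * norm x"
    using bounded_linear.bounded[OF bounded_linear_V, of s] assms by (auto simp: mult.commute)
  \<comment> \<open>\<open>V h\<close> is bounded from below, being close to the identity, and \<open>V s = V h V (s - h)\<close>\<close>
  have lower: "norm (V (s - h) z) \<le> 2 * norm (V s z)" if h: "0 < h" "h < s" "\<eta> h < 1 / 2" for h z
  proof -
    have "V h (V (s - h) z) = V s z"
      using V_add[of h "s - h" z] h by simp
    then have "norm (V s z - V (s - h) z) \<le> \<eta> h * norm (V (s - h) z)"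
      using V_near_id[OF h(1), of "V (s - h) z"] by simp
    also have "\<dots> \<le> 1 / 2 * norm (V (s - h) z)"
      using h by (intro mult_right_mono) auto
    finally show ?thesis
      using norm_triangle_ineq3[of "V s z" "V (s - h) z"] by simp
  qed
  let ?q = "\<lambda>h. (1 / h) *\<^sub>R (V h x - x)"
  define y where "y = endo_apply X x"
  have "((\<lambda>h. (1 / (- h)) *\<^sub>R (V (s - h) x - V s x)) \<longlongrightarrow> V s y) (at_right 0)"
  proof (rule Lim_null_comparison[where g = "\<lambda>h. 2 * (C * norm (?q h - y)) + \<eta> h * (2 * norm (V s y))",
        THEN LIM_zero_cancel])
    have "\<forall>\<^sub>F h in at_right 0. \<eta> h < 1 / 2"
      using \<eta>_tendsto by (rule order_tendstoD) simp
    moreover have "\<forall>\<^sub>F h in at_right 0. 0 < h \<and> h < s"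
      using assms by (intro eventually_conj eventually_at_right_less) (auto simp: eventually_at_right_field)
    ultimately show "\<forall>\<^sub>F h in at_right 0. norm ((1 / (- h)) *\<^sub>R (V (s - h) x - V s x) - V s y)
      \<le> 2 * (C * norm (?q h - y)) + \<eta> h * (2 * norm (V s y))"
    proof eventually_elim
      case (elim h)
      interpret V: bounded_linear "V (s - h)"
        using elim by (intro bounded_linear_V) auto
      have "V s x = V (s - h) (V h x)"
        using V_add[of "s - h" h x] elim by simp
      then have "(1 / (- h)) *\<^sub>R (V (s - h) x - V s x) = V (s - h) (?q h)"
        by (simp add: V.diff V.scaleR scaleR_diff_right)
      then have "(1 / (- h)) *\<^sub>R (V (s - h) x - V s x) - V s y
          = V (s - h) (?q h - y) + (V (s - h) y - V s y)" (is "?lhs = ?rhs")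
        by (simp add: V.diff)
      moreover have "norm (V (s - h) (?q h - y)) \<le> 2 * (C * norm (?q h - y))"
        using lower[of h "?q h - y"] C[of "?q h - y"] elim by simp
      moreover have "norm (V (s - h) y - V s y) \<le> \<eta> h * (2 * norm (V s y))"
      proof -
        have "V s y = V h (V (s - h) y)"
          using V_add[of h "s - h" y] elim by simp
        then have "norm (V (s - h) y - V s y) \<le> \<eta> h * norm (V (s - h) y)"
          using V_near_id[of h "V (s - h) y"] elim by (simp add: norm_minus_commute)
        \<comment> \<open>No sign of \<open>\<eta> h\<close> is assumed, but a negative value in
          \<open>V_near_id\<close> forces the vector to vanish.\<close>
        moreover have "0 \<le> \<eta> h \<or> V (s - h) y = 0"
          using order_trans[OF norm_ge_zero V_near_id[of h "V (s - h) y"]] elim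
          by (auto simp: zero_le_mult_iff)
        then have "\<eta> h * norm (V (s - h) y) \<le> \<eta> h * (2 * norm (V s y))"
        proof
          assume "V (s - h) y = 0"
          then show ?thesis
            using \<open>V s y = V h (V (s - h) y)\<close> linear_0[OF bounded_linear.linear[OF bounded_linear_V[of h]]] elim by simp
        qed (use lower[of h y] elim in \<open>auto intro: mult_left_mono\<close>)
        ultimately show ?thesis
          by (rule order_trans)
      qed
      ultimately show ?case
        by (simp only:) (rule order_trans[OF norm_triangle_ineq add_mono])
    qed
    have "((\<lambda>h. 2 * (C * norm (?q h - y)) + \<eta> h * (2 * norm (V s y)))
        \<longlongrightarrow> 2 * (C * norm (y - y)) + 0 * (2 * norm (V s y))) (at_right 0)"
      unfolding y_def by (intro tendsto_intros generator \<eta>_tendsto)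
    then show "((\<lambda>h. 2 * (C * norm (?q h - y)) + \<eta> h * (2 * norm (V s y))) \<longlongrightarrow> 0) (at_right 0)"
      by simp
  qed
  then have "((\<lambda>h. (1 / (s - h - s)) *\<^sub>R (V (s - h) x - V s x)) \<longlongrightarrow> endo_apply X (V s x)) (at_right 0)"
    using assms by (simp add: generator_commute y_def)
  then show ?thesis
    unfolding at_left_minus[of s] at_right_to_0[of "- s"] by (simp add: filterlim_filtermap)
qed

lemma has_vector_derivative_V:
  assumes "0 \<le> s"
  shows "((\<lambda>s. V s x) has_vector_derivative endo_apply X (V s x)) (at s within {0..})"
proof -
  have "((\<lambda>r. (1 / (r - s)) *\<^sub>R (V r x - V s x)) \<longlongrightarrow> endo_apply X (V s x)) (at s within {0..})"
  proof (cases "s = 0")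
    case True
    then show ?thesis
      using right_derivative[of 0] by (simp add: at_within_Ici_at_right)
  next
    case False
    then have "((\<lambda>r. (1 / (r - s)) *\<^sub>R (V r x - V s x)) \<longlongrightarrow> endo_apply X (V s x)) (at s)"
      using assms left_derivative right_derivative by (intro filterlim_split_at_real) auto
    then show ?thesis
      by (rule filterlim_mono) (auto intro: at_le)
  qed
  then show ?thesis
    by (simp add: has_vector_derivative_iff_quotient)
qed

text \<open>Moving \<open>V s x\<close> to time \<open>t\<close> by the exponential gives a constant
  function of \<open>s\<close>, evaluated at \<open>s = 0\<close> and \<open>s = t\<close>.\<close>

lemma V_eq_exp:
  assumes "0 \<le> t"
  shows "V t x = endo_apply (exp (t *\<^sub>R X)) x"
proof -
  have zero: "((\<lambda>s. endo_apply (exp ((t - s) *\<^sub>R X)) (V s x)) has_vector_derivative 0) (at s within {0..})"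
    if "s \<in> {0..}" for s
    using exp_endo_variation_of_constants[of "\<lambda>s. V s x" X s 0] has_vector_derivative_V[of s x] that
    by (simp add: endo.zero_right)
  obtain c where "\<And>s. s \<in> {0..} \<Longrightarrow> endo_apply (exp ((t - s) *\<^sub>R X)) (V s x) = c"
    using has_vector_derivative_zero_constant[OF convex_real_interval(1) zero] by blast
  from this[of 0] this[of t] assms show ?thesis
    by simp
qed

end

subsection \<open>Ordinary differential equations with a Lipschitz right-hand side\<close>

text \<open>
  With the weight \<open>e\<^sup>-\<^sup>2\<^sup>C\<^sup>t\<close> the Picard operator on the whole interval is a contraction with factor \<open>1/2\<close>.
\<close>

locale lipschitz_ode =
  fixes G :: "'a::banach \<Rightarrow> 'a" and C T :: real and x0 :: 'a
  assumes G_lipschitz: "\<And>x y. norm (G x - G y) \<le> C * norm (x - y)"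
    and C_pos: "0 < C" and T_nonneg: "0 \<le> T"
begin

lemma continuous_on_G: "continuous_on S G"
  by (rule lipschitz_on_continuous_on[where L = C])
    (use G_lipschitz C_pos in \<open>auto simp: lipschitz_on_def dist_norm\<close>)

text \<open>The nearest point of the interval. Composition with it turns continuous functions on
  \<open>{0..T}\<close> into bounded continuous functions on the line, which form a complete metric
  space as a type.\<close>

definition clip :: "real \<Rightarrow> real" where
  "clip t = max 0 (min T t)"

lemma clip_in: "clip t \<in> {0..T}"
  using T_nonneg by (auto simp: clip_def)

lemma clip_id: "t \<in> {0..T} \<Longrightarrow> clip t = t"
  by (auto simp: clip_def)

lemma bcontfun_clip:
  assumes "continuous_on {0..T} f"
  shows "(\<lambda>t. f (clip t)) \<in> bcontfun"
proof -
  have "continuous_on UNIV (\<lambda>t. f (clip t))"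
  proof (rule continuous_on_compose2[OF assms])
    show "continuous_on UNIV clip"
      unfolding clip_def by (intro continuous_intros)
  qed (use clip_in in auto)
  moreover have "bounded (range (\<lambda>t. f (clip t)))"
    by (rule bounded_subset[OF compact_imp_bounded[OF compact_continuous_image[OF assms compact_Icc]]])
      (use clip_in in auto)
  ultimately show ?thesis
    by (simp add: bcontfun_def)
qed

definition picard_integral :: "(real \<Rightarrow> 'a) \<Rightarrow> real \<Rightarrow> 'a" where
  "picard_integral f t = x0 + integral {0..t} (\<lambda>r. G (f r))"

lemma continuous_picard_integral:
  assumes "continuous_on {0..T} f"
  shows "continuous_on {0..T} (picard_integral f)"
  unfolding picard_integral_def
  using continuous_on_compose2[OF continuous_on_G assms subset_UNIV]
  by (intro continuous_intros indefinite_integral_continuous_1 integrable_continuous_interval) auto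

text \<open>The Picard operator conjugated by the weight: \<open>f\<close> represents the curve
  multiplied by \<open>exp (- 2 * C * t)\<close>, so the plain supremum distance of the type is the
  weighted distance of curves.\<close>

definition weighted_picard :: "(real \<Rightarrow>\<^sub>C 'a) \<Rightarrow> (real \<Rightarrow>\<^sub>C 'a)" where
  "weighted_picard f = Bcontfun
    (\<lambda>t. exp (- 2 * C * clip t) *\<^sub>R picard_integral (\<lambda>r. exp (2 * C * r) *\<^sub>R f r) (clip t))"

lemma apply_weighted_picard:
  "apply_bcontfun (weighted_picard f) t =
    exp (- 2 * C * clip t) *\<^sub>R picard_integral (\<lambda>r. exp (2 * C * r) *\<^sub>R f r) (clip t)"
  unfolding weighted_picard_def
  by (subst Bcontfun_inverse)
    (intro bcontfun_clip[of "\<lambda>t. exp (- 2 * C * t) *\<^sub>R picard_integral (\<lambda>r. exp (2 * C * r) *\<^sub>R f r) t"]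
      continuous_intros continuous_picard_integral continuous_on_apply_bcontfun refl)+

lemma weighted_picard_contraction: "dist (weighted_picard f) (weighted_picard g) \<le> 1 / 2 * dist f g"
proof (rule dist_bound)
  fix t
  define s d where "s = clip t" and "d = dist f g"
  have s: "0 \<le> s" "s \<le> T"
    using clip_in[of t] by (auto simp: s_def)
  let ?w = "\<lambda>f r. exp (2 * C * r) *\<^sub>R apply_bcontfun f r"
  have int: "(\<lambda>r. G (?w f r)) integrable_on {0..s}" for f
    by (intro integrable_continuous_interval continuous_on_compose2[OF continuous_on_G]) (auto intro!: continuous_intros)
  \<comment> \<open>The contraction factor arises here: integration divides by \<open>2 * C\<close>,
    while the Lipschitz estimate costs only a factor \<open>C\<close>.\<close>
  have exp_int: "((\<lambda>r. C * d * exp (2 * C * r)) has_integral d / 2 * exp (2 * C * s) - d / 2 * exp (2 * C * 0)) {0..s}"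
    using s C_pos
    by (intro fundamental_theorem_of_calculus)
      (auto intro!: derivative_eq_intros simp: has_real_derivative_iff_has_vector_derivative[symmetric])
  have "norm (integral {0..s} (\<lambda>r. G (?w f r)) - integral {0..s} (\<lambda>r. G (?w g r)))
      = norm (integral {0..s} (\<lambda>r. G (?w f r) - G (?w g r)))"
    using int by (simp add: Henstock_Kurzweil_Integration.integral_diff)
  also have "\<dots> \<le> integral {0..s} (\<lambda>r. C * d * exp (2 * C * r))"
  proof (rule integral_norm_bound_integral)
    fix r
    have "norm (G (?w f r) - G (?w g r)) \<le> C * norm (?w f r - ?w g r)"
      by (rule G_lipschitz)
    also have "norm (?w f r - ?w g r) = exp (2 * C * r) * dist (f r) (g r)"
      by (simp add: dist_norm flip: scaleR_diff_right)
    also have "\<dots> \<le> exp (2 * C * r) * d"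
      unfolding d_def by (intro mult_left_mono dist_bounded) auto
    finally show "norm (G (?w f r) - G (?w g r)) \<le> C * d * exp (2 * C * r)"
      using C_pos by (simp add: mult_ac)
  qed (use int exp_int in \<open>auto intro!: Henstock_Kurzweil_Integration.integrable_diff\<close>)
  also have "\<dots> \<le> d / 2 * exp (2 * C * s)"
    unfolding integral_unique[OF exp_int] by (simp add: d_def)
  finally have le: "norm (integral {0..s} (\<lambda>r. G (?w f r)) - integral {0..s} (\<lambda>r. G (?w g r)))
      \<le> d / 2 * exp (2 * C * s)" .
  have "dist (weighted_picard f t) (weighted_picard g t)
      = exp (- 2 * C * s) * norm (integral {0..s} (\<lambda>r. G (?w f r)) - integral {0..s} (\<lambda>r. G (?w g r)))"
    by (simp add: apply_weighted_picard picard_integral_def s_def dist_norm flip: scaleR_diff_right)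
  also have "\<dots> \<le> exp (- 2 * C * s) * (d / 2 * exp (2 * C * s))"
    using le by (intro mult_left_mono) auto
  also have "\<dots> = 1 / 2 * d"
    by (simp add: exp_minus)
  finally show "dist (weighted_picard f t) (weighted_picard g t) \<le> 1 / 2 * dist f g"
    by (simp add: d_def)
qed

lemma integral_equation_iff_fixed_point:
  assumes v: "continuous_on {0..T} v"
    and f: "\<And>t. apply_bcontfun f t = exp (- 2 * C * clip t) *\<^sub>R v (clip t)"
  shows "weighted_picard f = f \<longleftrightarrow> (\<forall>t\<in>{0..T}. v t = picard_integral v t)"
proof -
  have eq: "picard_integral (\<lambda>r. exp (2 * C * r) *\<^sub>R f r) t = picard_integral v t" if "t \<in> {0..T}" for t
    unfolding picard_integral_def
    by (intro arg_cong2[where f = "(+)"] refl Henstock_Kurzweil_Integration.integral_cong)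
      (use that in \<open>simp add: f clip_id mult_exp_exp\<close>)
  have "apply_bcontfun (weighted_picard f) t = exp (- 2 * C * clip t) *\<^sub>R picard_integral v (clip t)" for t
    by (simp only: apply_weighted_picard eq[OF clip_in])
  moreover have "weighted_picard f = f \<longleftrightarrow> (\<forall>t. apply_bcontfun (weighted_picard f) t = f t)"
    by (metis bcontfun_eqI)
  ultimately have "weighted_picard f = f \<longleftrightarrow> (\<forall>t. picard_integral v (clip t) = v (clip t))"
    by (simp add: f)
  also have "\<dots> \<longleftrightarrow> (\<forall>t\<in>{0..T}. v t = picard_integral v t)"
    using clip_in clip_id by metis
  finally show ?thesis .
qed

lemma derivative_imp_integral_equation:
  assumes v0: "v 0 = x0"
    and v: "\<And>t. t \<in> {0..T} \<Longrightarrow> (v has_vector_derivative G (v t)) (at t within {0..T})"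
    and t: "t \<in> {0..T}"
  shows "v t = picard_integral v t"
proof -
  have "((\<lambda>r. G (v r)) has_integral v t - v 0) {0..t}"
    using t by (intro fundamental_theorem_of_calculus)
      (auto intro: has_vector_derivative_within_subset[OF v])
  then show ?thesis
    using v0 by (simp add: picard_integral_def integral_unique)
qed

theorem exists_unique_solution:
  obtains u where "u 0 = x0"
    "\<And>t. t \<in> {0..T} \<Longrightarrow> (u has_vector_derivative G (u t)) (at t within {0..T})"
    "\<And>v t. v 0 = x0 \<Longrightarrow> (\<And>t. t \<in> {0..T} \<Longrightarrow> (v has_vector_derivative G (v t)) (at t within {0..T}))
      \<Longrightarrow> t \<in> {0..T} \<Longrightarrow> v t = u t"
proof -
  have "\<exists>!f. weighted_picard f = f"
    by (rule banach_fix_type[where c = "1 / 2"]) (use weighted_picard_contraction in auto)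
  then obtain f where f: "weighted_picard f = f" and unique: "\<And>g. weighted_picard g = g \<Longrightarrow> g = f"
    by blast
  define u where "u t = exp (2 * C * t) *\<^sub>R f t" for t
  have u_cont: "continuous_on {0..T} u"
    unfolding u_def by (intro continuous_intros) auto
  \<comment> \<open>The value of \<open>weighted_picard f\<close> at \<open>t\<close> depends on
    \<open>t\<close> only through \<open>clip t\<close>, so a fixed point is constant on either side
    of the interval.\<close>
  have f_clip: "f t = f (clip t)" for t
    by (subst (1 2) f[symmetric]) (simp add: apply_weighted_picard clip_id[OF clip_in])
  then have fu: "f t = exp (- 2 * C * clip t) *\<^sub>R u (clip t)" for t
    by (simp add: u_def mult_exp_exp)
  have u_eq: "u t = picard_integral u t" if "t \<in> {0..T}" for t
    using integral_equation_iff_fixed_point[OF u_cont fu] f that by blast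
  show thesis
  proof
    show "u 0 = x0"
      using u_eq[of 0] T_nonneg by (simp add: picard_integral_def)
    show "(u has_vector_derivative G (u t)) (at t within {0..T})" if t: "t \<in> {0..T}" for t
    proof -
      have "((\<lambda>t. integral {0..t} (\<lambda>r. G (u r))) has_vector_derivative G (u t)) (at t within {0..T})"
        using t by (intro integral_has_vector_derivative continuous_on_compose2[OF continuous_on_G u_cont]) auto
      then have "(picard_integral u has_vector_derivative G (u t)) (at t within {0..T})"
        unfolding picard_integral_def by (auto intro!: derivative_eq_intros)
      then show ?thesis
        by (rule has_vector_derivative_transform[OF t, rotated]) (use u_eq in auto)
    qed
    show "v t = u t"
      if v0: "v 0 = x0" and v: "\<And>t. t \<in> {0..T} \<Longrightarrow> (v has_vector_derivative G (v t)) (at t within {0..T})"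
        and t: "t \<in> {0..T}" for v t
    proof -
      have v_cont: "continuous_on {0..T} v"
        using v by (meson continuous_on_eq_continuous_within has_vector_derivative_continuous)
      have "(\<lambda>t. exp (- 2 * C * clip t) *\<^sub>R v (clip t)) \<in> bcontfun"
        by (intro bcontfun_clip[of "\<lambda>t. exp (- 2 * C * t) *\<^sub>R v t"] continuous_intros v_cont)
      then obtain g where "(\<lambda>t. exp (- 2 * C * clip t) *\<^sub>R v (clip t)) = apply_bcontfun g"
        by (rule bcontfunE)
      then have g: "apply_bcontfun g t = exp (- 2 * C * clip t) *\<^sub>R v (clip t)" for t
        by (rule fun_cong[symmetric])
      have "weighted_picard g = g"
        using integral_equation_iff_fixed_point[OF v_cont g] derivative_imp_integral_equation[OF v0 v] by blast
      then show ?thesis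
        using g[of t] fu[of t] unique t by (auto simp: clip_id)
    qed
  qed
qed

end

subsection \<open>A Banach space containing all the spaces \<open>L\<^sup>p((0,1))\<close>\<close>

text \<open>
  The \<open>\<ell>\<^sup>\<infinity>\<close>-sum of the spaces \<open>L\<^sup>q((0,1))\<close> over all real indices \<open>q\<close>, where indices below 1 are read as
  \<open>q = 1\<close>. It is one type into which every \<open>Lp p\<close> embeds isometrically, so that the
  library's calculus in Banach spaces applies to functions with values in \<open>Lp p\<close>.
\<close>

typedef Lp_family =
  "{F :: real \<Rightarrow> L0. (\<forall>q. F q \<in> Lp (max 1 q)) \<and> bdd_above (range (\<lambda>q. Lp_norm (max 1 q) (F q)))}"
  morphisms component Lp_family
  by (rule exI[of _ "\<lambda>_. 0"]) simp

setup_lifting type_definition_Lp_family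

lemma component_in_Lp_max: "component F q \<in> Lp (max 1 q)"
  using component[of F] by simp

instantiation Lp_family :: real_vector
begin

lift_definition zero_Lp_family :: Lp_family is "\<lambda>_. 0"
  by simp

lift_definition scaleR_Lp_family :: "real \<Rightarrow> Lp_family \<Rightarrow> Lp_family" is "\<lambda>c F q. c *\<^sub>R F q"
proof (intro CollectI conjI allI; elim CollectE conjE)
  fix c and F :: "real \<Rightarrow> L0"
  assume F: "\<forall>q. F q \<in> Lp (max 1 q)" and bdd: "bdd_above (range (\<lambda>q. Lp_norm (max 1 q) (F q)))"
  show "c *\<^sub>R F q \<in> Lp (max 1 q)" for q
    using F by (intro Lp_scaleR) auto
  obtain B where "Lp_norm (max 1 q) (F q) \<le> B" for q
    using bdd by (auto simp: bdd_above_def)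
  then show "bdd_above (range (\<lambda>q. Lp_norm (max 1 q) (c *\<^sub>R F q)))"
    by (intro bdd_aboveI2[where M = "\<bar>c\<bar> * B"]) (simp add: Lp_norm_scaleR mult_left_mono)
qed

lift_definition plus_Lp_family :: "Lp_family \<Rightarrow> Lp_family \<Rightarrow> Lp_family" is "\<lambda>F G q. F q + G q"
proof (intro CollectI conjI allI; elim CollectE conjE)
  fix F G :: "real \<Rightarrow> L0"
  assume FG: "\<forall>q. F q \<in> Lp (max 1 q)" "\<forall>q. G q \<in> Lp (max 1 q)"
    and bdd: "bdd_above (range (\<lambda>q. Lp_norm (max 1 q) (F q)))"
      "bdd_above (range (\<lambda>q. Lp_norm (max 1 q) (G q)))"
  show "F q + G q \<in> Lp (max 1 q)" for q
    using FG by (intro Lp_add) auto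
  obtain B C where "Lp_norm (max 1 q) (F q) \<le> B" "Lp_norm (max 1 q) (G q) \<le> C" for q
    using bdd by (auto simp: bdd_above_def)
  then show "bdd_above (range (\<lambda>q. Lp_norm (max 1 q) (F q + G q)))"
    using FG by (intro bdd_aboveI2[where M = "B + C"])
      (intro order_trans[OF Lp_norm_triangle add_mono], auto)
qed

lift_definition uminus_Lp_family :: "Lp_family \<Rightarrow> Lp_family" is "\<lambda>F q. - F q"
  by (simp add: Lp_minus)

definition minus_Lp_family :: "Lp_family \<Rightarrow> Lp_family \<Rightarrow> Lp_family" where
  "minus_Lp_family F G = F + - G"

instance
proof
  fix F G H :: Lp_family and a b :: real
  show "F + G + H = F + (G + H)" "F + G = G + F"
    by (transfer, simp add: fun_eq_iff add_ac)+
  show "0 + F = F" "- F + F = 0" "1 *\<^sub>R F = F" "a *\<^sub>R b *\<^sub>R F = (a * b) *\<^sub>R F"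
    by (transfer, simp)+
  show "F - G = F + - G"
    by (rule minus_Lp_family_def)
  show "a *\<^sub>R (F + G) = a *\<^sub>R F + a *\<^sub>R G" "(a + b) *\<^sub>R F = a *\<^sub>R F + b *\<^sub>R F"
    by (transfer, simp add: fun_eq_iff scaleR_add_right scaleR_add_left)+
qed

end

lemma component_zero [simp]: "component 0 q = 0"
  by (simp add: zero_Lp_family.rep_eq)

lemma component_add [simp]: "component (F + G) q = component F q + component G q"
  by (simp add: plus_Lp_family.rep_eq)

lemma component_diff [simp]: "component (F - G) q = component F q - component G q"
  unfolding minus_Lp_family_def plus_Lp_family.rep_eq uminus_Lp_family.rep_eq by simp

lemma component_scaleR [simp]: "component (c *\<^sub>R F) q = c *\<^sub>R component F q"
  by (simp add: scaleR_Lp_family.rep_eq)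

lemma Lp_family_eqI: "(\<And>q. component F q = component G q) \<Longrightarrow> F = G"
  by (simp add: component_inject[symmetric] fun_eq_iff)

instantiation Lp_family :: real_normed_vector
begin

definition norm_Lp_family :: "Lp_family \<Rightarrow> real" where
  "norm_Lp_family F = (SUP q. Lp_norm (max 1 q) (component F q))"

definition dist_Lp_family :: "Lp_family \<Rightarrow> Lp_family \<Rightarrow> real" where
  "dist_Lp_family F G = norm (F - G)"

definition sgn_Lp_family :: "Lp_family \<Rightarrow> Lp_family" where
  "sgn_Lp_family F = F /\<^sub>R norm F"

definition uniformity_Lp_family :: "(Lp_family \<times> Lp_family) filter" where
  "uniformity_Lp_family = (INF e\<in>{0<..}. principal {(F, G). dist F G < e})"

definition open_Lp_family :: "Lp_family set \<Rightarrow> bool" where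
  "open_Lp_family U = (\<forall>F\<in>U. eventually (\<lambda>(F', G). F' = F \<longrightarrow> G \<in> U) uniformity)"

lemma Lp_norm_component_le: "Lp_norm (max 1 q) (component F q) \<le> norm F"
  unfolding norm_Lp_family_def using component[of F] by (intro cSUP_upper) auto

lemma Lp_family_norm_le: "(\<And>q. Lp_norm (max 1 q) (component F q) \<le> B) \<Longrightarrow> norm F \<le> B"
  unfolding norm_Lp_family_def by (intro cSUP_least) auto

instance
proof
  fix F G :: Lp_family and a :: real
  show "norm F = 0 \<longleftrightarrow> F = 0"
  proof
    assume "norm F = 0"
    then have "Lp_norm (max 1 q) (component F q) = 0" for q
      using Lp_norm_component_le[of q F] by (simp add: order_antisym)
    then have "component F q = 0" for q
      using Lp_norm_eq_0_iff[OF _ component_in_Lp_max, of q F] by simp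
    then show "F = 0"
      by (intro Lp_family_eqI) simp
  qed (simp add: norm_Lp_family_def)
  show "norm (F + G) \<le> norm F + norm G"
  proof (rule Lp_family_norm_le)
    fix q
    have "Lp_norm (max 1 q) (component (F + G) q)
        \<le> Lp_norm (max 1 q) (component F q) + Lp_norm (max 1 q) (component G q)"
      by (auto intro: Lp_norm_triangle component_in_Lp_max)
    also have "\<dots> \<le> norm F + norm G"
      by (intro add_mono Lp_norm_component_le)
    finally show "Lp_norm (max 1 q) (component (F + G) q) \<le> norm F + norm G" .
  qed
  show "norm (a *\<^sub>R F) = \<bar>a\<bar> * norm F"
  proof (cases "a = 0")
    case True
    then show ?thesis
      by (simp add: norm_Lp_family_def)
  next
    case False
    show ?thesis
    proof (rule antisym)
      show "norm (a *\<^sub>R F) \<le> \<bar>a\<bar> * norm F"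
        by (rule Lp_family_norm_le) (simp add: Lp_norm_scaleR mult_left_mono Lp_norm_component_le)
      have "norm F \<le> norm (a *\<^sub>R F) / \<bar>a\<bar>"
      proof (rule Lp_family_norm_le)
        fix q
        show "Lp_norm (max 1 q) (component F q) \<le> norm (a *\<^sub>R F) / \<bar>a\<bar>"
          using Lp_norm_component_le[of q "a *\<^sub>R F"] False by (simp add: Lp_norm_scaleR field_simps)
      qed
      then show "\<bar>a\<bar> * norm F \<le> norm (a *\<^sub>R F)"
        using False by (simp add: field_simps)
    qed
  qed
qed (rule dist_Lp_family_def sgn_Lp_family_def uniformity_Lp_family_def open_Lp_family_def)+

end

text \<open>Each component converges by \<open>Lp_complete\<close>. The Cauchy condition is uniform
  in \<open>q\<close>, and so is the resulting bound in \<open>close\<close>: the auxiliary index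
  \<open>m\<close> depends on \<open>q\<close> and \<open>d\<close>, but disappears as
  \<open>d\<close> tends to 0.\<close>

instance Lp_family :: banach
proof
  fix X :: "nat \<Rightarrow> Lp_family"
  assume X: "Cauchy X"
  have le: "Lp_norm (max 1 q) (component (X m) q - component (X n) q) \<le> norm (X m - X n)" for q m n
    using Lp_norm_component_le[of q "X m - X n"] by simp
  have "\<exists>l\<in>Lp (max 1 q). \<forall>e>0. \<exists>N. \<forall>n\<ge>N. Lp_norm (max 1 q) (component (X n) q - l) \<le> e" for q
  proof (rule Lp_complete)
    show "\<exists>N. \<forall>m\<ge>N. \<forall>n\<ge>N. Lp_norm (max 1 q) (component (X m) q - component (X n) q) < e" if "0 < e" for e
      using X le that unfolding Cauchy_iff by (meson le_less_trans)
  qed (auto intro: component_in_Lp_max)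
  then obtain l where l: "l q \<in> Lp (max 1 q)"
    and lim: "\<And>e. 0 < e \<Longrightarrow> \<exists>N. \<forall>n\<ge>N. Lp_norm (max 1 q) (component (X n) q - l q) \<le> e" for q
    by metis
  have close: "Lp_norm (max 1 q) (component (X n) q - l q) \<le> e"
    if N: "\<And>m n. m \<ge> N \<Longrightarrow> n \<ge> N \<Longrightarrow> norm (X m - X n) < e" and n: "n \<ge> N" for e N n q
  proof (rule field_le_epsilon)
    fix d :: real assume "0 < d"
    then obtain M where M: "\<And>n. n \<ge> M \<Longrightarrow> Lp_norm (max 1 q) (component (X n) q - l q) \<le> d"
      using lim by blast
    define m where "m = max M N"
    have "component (X n) q - l q = (component (X n) q - component (X m) q) + (component (X m) q - l q)"
      by simp
    also have "Lp_norm (max 1 q) \<dots> \<le> Lp_norm (max 1 q) (component (X n) q - component (X m) q)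
        + Lp_norm (max 1 q) (component (X m) q - l q)"
      by (intro Lp_norm_triangle Lp_diff component_in_Lp_max l) auto
    also have "\<dots> \<le> e + d"
      using M[of m] le[where q = q and m = n and n = m] N[of n m] n by (simp add: m_def)
    finally show "Lp_norm (max 1 q) (component (X n) q - l q) \<le> e + d" .
  qed
  obtain N where N: "\<And>m n. m \<ge> N \<Longrightarrow> n \<ge> N \<Longrightarrow> norm (X m - X n) < 1"
    using X unfolding Cauchy_iff by (meson zero_less_one)
  have "Lp_norm (max 1 q) (l q) \<le> norm (X N) + 1" for q
  proof -
    have "Lp_norm (max 1 q) (component (X N) q + - (component (X N) q - l q))
        \<le> Lp_norm (max 1 q) (component (X N) q) + Lp_norm (max 1 q) (- (component (X N) q - l q))"
      by (intro Lp_norm_triangle Lp_minus Lp_diff component_in_Lp_max l) auto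
    moreover have "Lp_norm (max 1 q) (component (X N) q - l q) \<le> 1"
      by (rule close[OF N]) auto
    ultimately show ?thesis
      using Lp_norm_component_le[of q "X N"] by (simp add: Lp_norm_minus_commute)
  qed
  then have "l \<in> {F. (\<forall>q. F q \<in> Lp (max 1 q)) \<and> bdd_above (range (\<lambda>q. Lp_norm (max 1 q) (F q)))}"
    using l by (auto intro!: bdd_aboveI2[where M = "norm (X N) + 1"])
  then have component_l: "component (Lp_family l) q = l q" for q
    by (simp add: Lp_family_inverse)
  have "\<exists>N. \<forall>n\<ge>N. norm (X n - Lp_family l) < e" if "0 < e" for e
  proof -
    obtain N where N: "\<And>m n. m \<ge> N \<Longrightarrow> n \<ge> N \<Longrightarrow> norm (X m - X n) < e / 2"
      using X half_gt_zero[OF \<open>0 < e\<close>] unfolding Cauchy_iff by meson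
    have "norm (X n - Lp_family l) \<le> e / 2" if "n \<ge> N" for n
      using close[OF N] that by (intro Lp_family_norm_le) (simp add: component_l)
    then show ?thesis
      using that by (intro exI[of _ N]) force
  qed
  then have "X \<longlonglongrightarrow> Lp_family l"
    by (simp add: LIMSEQ_iff)
  then show "convergent X"
    by (rule convergentI)
qed

text \<open>Outside \<open>Lp p\<close>, or for \<open>p\<close> below 1, the zero family is a
  default value; linearity and isometry are therefore stated for members of
  \<open>Lp p\<close>.\<close>

lift_definition embed :: "real \<Rightarrow> L0 \<Rightarrow> Lp_family" is
  "\<lambda>p u q. if q = p \<and> 1 \<le> p \<and> u \<in> Lp p then u else 0"
proof (intro CollectI conjI allI)
  fix p :: real and u
  show "(if q = p \<and> 1 \<le> p \<and> u \<in> Lp p then u else 0) \<in> Lp (max 1 q)" for q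
    by (auto simp: max_def)
  show "bdd_above (range (\<lambda>q. Lp_norm (max 1 q) (if q = p \<and> 1 \<le> p \<and> u \<in> Lp p then u else 0)))"
    by (rule bdd_aboveI2[where M = "Lp_norm p u"]) (auto simp: max_def)
qed

text \<open>Provides the unit of the operator algebra. Small multiples of one nonzero vector, the
  constant function 1 at index 1, already show that no point is isolated.\<close>

instance Lp_family :: perfect_space
proof
  fix x :: Lp_family
  show "\<not> open {x}"
  proof
    assume "open {x}"
    then obtain e where e: "0 < e" "ball x e \<subseteq> {x}"
      by (auto simp: open_contains_ball)
    define c where "c = embed 1 (abs_L0 (\<lambda>_. 1))"
    have one: "abs_L0 (\<lambda>_. 1) \<in> Lp 1" "Lp_norm 1 (abs_L0 (\<lambda>_. 1)) = 1"
      by (auto simp: abs_L0_in_Lp_iff Lp_norm_abs_L0)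
    then have "c \<noteq> 0"
      using Lp_norm_zero[of 1] component_zero[of 1] by (auto simp: c_def embed.rep_eq dest!: arg_cong[where f = "\<lambda>F. component F 1"])
    then have "x + (e / (2 * norm c)) *\<^sub>R c \<in> ball x e"
      using e by (simp add: dist_norm)
    then have "(e / (2 * norm c)) *\<^sub>R c = 0"
      using e by auto
    then show False
      using \<open>c \<noteq> 0\<close> e by simp
  qed
qed

subsection \<open>Calculus in \<open>L\<^sup>p((0,1))\<close>\<close>

locale Lp_space =
  fixes p :: real
  assumes p: "1 \<le> p"
begin

abbreviation emb :: "L0 \<Rightarrow> Lp_family" where
  "emb \<equiv> embed p"

abbreviation prj :: "Lp_family \<Rightarrow> L0" where
  "prj F \<equiv> component F p"

lemma prj_in_Lp [simp]: "prj F \<in> Lp p"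
  using component_in_Lp_max[of F p] p by (simp add: max_def split: if_splits)

lemma Lp_norm_prj_le: "Lp_norm p (prj F) \<le> norm F"
  using Lp_norm_component_le[of p F] p by (simp add: max_def split: if_splits)

lemma prj_emb [simp]: "u \<in> Lp p \<Longrightarrow> prj (emb u) = u"
  using p by (simp add: embed.rep_eq)

lemma norm_emb:
  assumes "u \<in> Lp p"
  shows "norm (emb u) = Lp_norm p u"
proof (rule antisym)
  show "norm (emb u) \<le> Lp_norm p u"
    using p by (intro Lp_family_norm_le) (auto simp: embed.rep_eq max_def)
  show "Lp_norm p u \<le> norm (emb u)"
    using Lp_norm_prj_le[of "emb u"] assms by simp
qed

lemma emb_zero [simp]: "emb 0 = 0"
  by (intro Lp_family_eqI) (simp add: embed.rep_eq)

lemma emb_add: "u \<in> Lp p \<Longrightarrow> v \<in> Lp p \<Longrightarrow> emb (u + v) = emb u + emb v"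
  using p Lp_add[of p u v] by (intro Lp_family_eqI) (simp add: embed.rep_eq)

lemma emb_diff: "u \<in> Lp p \<Longrightarrow> v \<in> Lp p \<Longrightarrow> emb (u - v) = emb u - emb v"
  using p Lp_diff[of p u v] by (intro Lp_family_eqI) (simp add: embed.rep_eq)

lemma emb_scaleR: "u \<in> Lp p \<Longrightarrow> emb (c *\<^sub>R u) = c *\<^sub>R emb u"
  using p Lp_scaleR[of u p c] by (intro Lp_family_eqI) (simp add: embed.rep_eq)

lemma emb_sum: "(\<And>i. i \<in> I \<Longrightarrow> u i \<in> Lp p) \<Longrightarrow> emb (sum u I) = (\<Sum>i\<in>I. emb (u i))"
  using p by (induction I rule: infinite_finite_induct) (auto simp: emb_add Lp_sum)

lemma Lp_norm_diff_emb: "u \<in> Lp p \<Longrightarrow> v \<in> Lp p \<Longrightarrow> Lp_norm p (u - v) = norm (emb u - emb v)"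
  using p by (simp add: emb_diff[symmetric] norm_emb Lp_diff)

text \<open>Extends an operator on \<open>Lp p\<close> to the whole space by letting it vanish on
  the other components.\<close>

lemma bounded_linear_prj_extension:
  assumes "Lp_bounded_linear p A"
  shows "bounded_linear (\<lambda>x. emb (A (prj x)))"
proof -
  obtain C where A: "\<And>f. f \<in> Lp p \<Longrightarrow> A f \<in> Lp p" and C: "\<And>f. f \<in> Lp p \<Longrightarrow> Lp_norm p (A f) \<le> C * Lp_norm p f"
    and lin: "\<And>f g. f \<in> Lp p \<Longrightarrow> g \<in> Lp p \<Longrightarrow> A (f + g) = A f + A g"
      "\<And>c f. f \<in> Lp p \<Longrightarrow> A (c *\<^sub>R f) = c *\<^sub>R A f"
    using assms unfolding Lp_bounded_linear_def by blast
  show ?thesis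
  proof (rule bounded_linear_intro[where K = "\<bar>C\<bar>"])
    fix x
    have "norm (emb (A (prj x))) \<le> C * Lp_norm p (prj x)"
      using A C by (simp add: norm_emb)
    also have "\<dots> \<le> \<bar>C\<bar> * norm x"
      by (intro mult_mono Lp_norm_prj_le) auto
    finally show "norm (emb (A (prj x))) \<le> norm x * \<bar>C\<bar>"
      by (simp add: mult.commute)
  qed (simp_all add: A lin emb_add emb_scaleR)
qed

lemma bounded_linear_emb_prj: "bounded_linear (\<lambda>x. emb (prj x))"
  by (rule bounded_linear_prj_extension) (auto simp: Lp_bounded_linear_def intro!: exI[of _ 1])

text \<open>As \<open>emb\<close> is isometric on \<open>Lp p\<close>, convergence there is
  convergence in the type \<open>Lp_family\<close>; continuity and derivatives are translated
  through this equivalence.\<close>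

lemma Lp_tendsto_iff:
  "Lp_tendsto p F l G \<longleftrightarrow> l \<in> Lp p \<and> (\<forall>\<^sub>F s in G. F s \<in> Lp p) \<and> ((\<lambda>s. emb (F s)) \<longlongrightarrow> emb l) G"
proof -
  have "((\<lambda>s. Lp_norm p (F s - l)) \<longlongrightarrow> 0) G \<longleftrightarrow> ((\<lambda>s. emb (F s)) \<longlongrightarrow> emb l) G"
    if l: "l \<in> Lp p" and F: "\<forall>\<^sub>F s in G. F s \<in> Lp p"
  proof -
    have "\<forall>\<^sub>F s in G. Lp_norm p (F s - l) = norm (emb (F s) - emb l)"
      using F by eventually_elim (simp add: l Lp_norm_diff_emb)
    then have "((\<lambda>s. Lp_norm p (F s - l)) \<longlongrightarrow> 0) G \<longleftrightarrow> ((\<lambda>s. norm (emb (F s) - emb l)) \<longlongrightarrow> 0) G"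
      by (rule filterlim_cong[OF refl refl])
    also have "\<dots> \<longleftrightarrow> ((\<lambda>s. emb (F s)) \<longlongrightarrow> emb l) G"
      by (simp add: tendsto_norm_zero_iff LIM_zero_iff)
    finally show ?thesis .
  qed
  then show ?thesis
    unfolding Lp_tendsto_def by blast
qed

lemma Lp_continuous_on_iff:
  assumes "\<And>s. s \<in> S \<Longrightarrow> F s \<in> Lp p"
  shows "Lp_continuous_on p S F \<longleftrightarrow> continuous_on S (\<lambda>s. emb (F s))"
  using assms unfolding Lp_continuous_on_def continuous_on_def Lp_tendsto_iff
  by (auto simp: eventually_at_filter)

lemma Lp_has_derivative_iff:
  assumes F: "\<And>s. s \<in> S \<Longrightarrow> F s \<in> Lp p" and t: "t \<in> S" and D: "D \<in> Lp p"
  shows "Lp_has_derivative p F D t S \<longleftrightarrow> ((\<lambda>s. emb (F s)) has_vector_derivative emb D) (at t within S)"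
proof -
  have "\<forall>\<^sub>F s in at t within S. (1 / (s - t)) *\<^sub>R (F s - F t) \<in> Lp p"
    using F t p by (auto simp: eventually_at_filter intro!: always_eventually Lp_scaleR Lp_diff)
  moreover have "\<forall>\<^sub>F s in at t within S. emb ((1 / (s - t)) *\<^sub>R (F s - F t)) = (1 / (s - t)) *\<^sub>R (emb (F s) - emb (F t))"
    using F t p by (auto simp: eventually_at_filter emb_scaleR Lp_diff emb_diff)
  note filterlim_cong[OF refl refl this]
  ultimately show ?thesis
    using D by (simp add: Lp_has_derivative_def Lp_tendsto_iff has_vector_derivative_iff_quotient)
qed

subsection \<open>Uniformly continuous semigroups\<close>

lemma Lp_opnorm_le:
  assumes "\<And>f. f \<in> Lp p \<Longrightarrow> Lp_norm p f \<le> 1 \<Longrightarrow> Lp_norm p (A f) \<le> B"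
  shows "Lp_opnorm p A \<le> B"
  unfolding Lp_opnorm_def using assms
  by (intro cSUP_least) (auto intro: exI[of _ 0])

text \<open>The supremum in \<open>Lp_opnorm\<close> is informative only for a set bounded above,
  which boundedness of \<open>A\<close> ensures. The second bound follows by scaling
  \<open>f\<close> to norm 1.\<close>

lemma
  assumes A: "Lp_bounded_linear p A"
  shows Lp_opnorm_nonneg: "0 \<le> Lp_opnorm p A"
    and Lp_norm_le_opnorm: "f \<in> Lp p \<Longrightarrow> Lp_norm p (A f) \<le> Lp_opnorm p A * Lp_norm p f"
proof -
  obtain C where C: "\<And>f. f \<in> Lp p \<Longrightarrow> Lp_norm p (A f) \<le> C * Lp_norm p f"
    and scale: "\<And>c f. f \<in> Lp p \<Longrightarrow> A (c *\<^sub>R f) = c *\<^sub>R A f"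
    using A unfolding Lp_bounded_linear_def by blast
  have "Lp_norm p (A f) \<le> \<bar>C\<bar>" if "f \<in> Lp p" "Lp_norm p f \<le> 1" for f
  proof -
    have "Lp_norm p (A f) \<le> C * Lp_norm p f"
      using C that by simp
    also have "\<dots> \<le> \<bar>C\<bar> * 1"
      using that by (intro mult_mono) auto
    finally show ?thesis
      by simp
  qed
  then have "bdd_above ((\<lambda>f. Lp_norm p (A f)) ` {f \<in> Lp p. Lp_norm p f \<le> 1})"
    by (auto intro!: bdd_aboveI[where M = "\<bar>C\<bar>"])
  then have le: "Lp_norm p (A f) \<le> Lp_opnorm p A" if "f \<in> Lp p" "Lp_norm p f \<le> 1" for f
    unfolding Lp_opnorm_def using that by (intro cSUP_upper) auto
  show "0 \<le> Lp_opnorm p A"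
    using order_trans[OF Lp_norm_nonneg le[of 0]] by simp
  show "Lp_norm p (A f) \<le> Lp_opnorm p A * Lp_norm p f" if f: "f \<in> Lp p"
  proof (cases "Lp_norm p f = 0")
    case True
    then show ?thesis
      using C[OF f] by simp
  next
    case False
    then have pos: "0 < Lp_norm p f"
      using Lp_norm_nonneg[of p f] by linarith
    have "Lp_norm p (A ((1 / Lp_norm p f) *\<^sub>R f)) \<le> Lp_opnorm p A"
      using f p pos by (intro le Lp_scaleR) (auto simp: Lp_norm_scaleR)
    then show ?thesis
      using f p pos by (simp add: scale Lp_norm_scaleR field_simps)
  qed
qed

lemma Lp_bounded_linear_diff_id:
  assumes A: "Lp_bounded_linear p A"
  shows "Lp_bounded_linear p (\<lambda>f. A f - f)"
proof -
  obtain C where A: "\<And>f. f \<in> Lp p \<Longrightarrow> A f \<in> Lp p" and C: "\<And>f. f \<in> Lp p \<Longrightarrow> Lp_norm p (A f) \<le> C * Lp_norm p f"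
    and lin: "\<And>f g. f \<in> Lp p \<Longrightarrow> g \<in> Lp p \<Longrightarrow> A (f + g) = A f + A g"
      "\<And>c f. f \<in> Lp p \<Longrightarrow> A (c *\<^sub>R f) = c *\<^sub>R A f"
    using assms unfolding Lp_bounded_linear_def by blast
  have "Lp_norm p (A f - f) \<le> (C + 1) * Lp_norm p f" if f: "f \<in> Lp p" for f
    using Lp_norm_triangle[OF p A[OF f] Lp_minus[OF f]] C[OF f] by (simp add: algebra_simps)
  moreover have "A (f + g) - (f + g) = A f - f + (A g - g)" if "f \<in> Lp p" "g \<in> Lp p" for f g
    using lin(1)[OF that] by (simp only: add_diff_add)
  moreover have "A (c *\<^sub>R f) - c *\<^sub>R f = c *\<^sub>R (A f - f)" if "f \<in> Lp p" for c f
    using lin(2)[OF that] by (simp only: scaleR_diff_right)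
  moreover have "A f - f \<in> Lp p" if "f \<in> Lp p" for f
    using Lp_diff[OF p A[OF that] that] .
  ultimately show ?thesis
    unfolding Lp_bounded_linear_def by (intro conjI ballI allI exI[of _ "C + 1"])
qed

context
  fixes A :: "L0 \<Rightarrow> L0" and X :: "Lp_family endo"
  assumes A: "Lp_bounded_linear p A" and X: "\<And>x. endo_apply X x = emb (A (prj x))"
begin

lemma A_in_Lp [simp]: "f \<in> Lp p \<Longrightarrow> A f \<in> Lp p"
  using A by (simp add: Lp_bounded_linear_def)

text \<open>\<open>X\<close> sees only \<open>prj x\<close> and takes values in the range of
  \<open>emb\<close>, so it commutes with \<open>emb \<circ> prj\<close>; the exponential inherits
  this.\<close>

lemma exp_emb:
  assumes "f \<in> Lp p"
  shows "emb (prj (endo_apply (exp (t *\<^sub>R X)) (emb f))) = endo_apply (exp (t *\<^sub>R X)) (emb f)"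
proof -
  have "emb (prj (endo_apply X x)) = endo_apply X (emb (prj x))" for x
    unfolding X by simp
  from exp_endo_invariant[OF bounded_linear_emb_prj this, where x = "emb f"] show ?thesis
    unfolding prj_emb[OF assms] .
qed

text \<open>The existence half for the choice in \<open>Lp_semigroup\<close>.\<close>

lemma exp_is_semigroup:
  defines "S \<equiv> \<lambda>t f. prj (endo_apply (exp (t *\<^sub>R X)) (emb f))"
  shows "uniformly_continuous_semigroup p S" "is_generator p A S"
proof -
  have emb_S: "emb (S t f) = endo_apply (exp (t *\<^sub>R X)) (emb f)" if "f \<in> Lp p" for t f
    using exp_emb[OF that] by (simp add: S_def)
  have bl: "Lp_bounded_linear p (S t)" for t
  proof -
    have "Lp_norm p (S t f) \<le> norm (exp (t *\<^sub>R X)) * Lp_norm p f" if "f \<in> Lp p" for f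
      using norm_endo_apply[of "exp (t *\<^sub>R X)" "emb f"] Lp_norm_prj_le that
      by (auto simp: S_def norm_emb intro: order_trans)
    then show ?thesis
      unfolding Lp_bounded_linear_def
      by (auto simp: S_def emb_add emb_scaleR endo.add_right endo.scaleR_right)
  qed
  have "((\<lambda>h. Lp_opnorm p (\<lambda>f. S h f - f)) \<longlongrightarrow> 0) (at_right 0)"
  proof (rule tendsto_sandwich)
    show "\<forall>\<^sub>F h in at_right 0. 0 \<le> Lp_opnorm p (\<lambda>f. S h f - f)"
      by (intro always_eventually allI Lp_opnorm_nonneg Lp_bounded_linear_diff_id bl)
    show "\<forall>\<^sub>F h in at_right 0. Lp_opnorm p (\<lambda>f. S h f - f) \<le> norm (exp (h *\<^sub>R X) - 1)"
    proof (intro always_eventually allI Lp_opnorm_le)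
      fix h f assume f: "f \<in> Lp p" "Lp_norm p f \<le> 1"
      have "S h f - f = prj (endo_apply (exp (h *\<^sub>R X) - 1) (emb f))"
        using f by (simp add: S_def endo.diff_left)
      also have "Lp_norm p \<dots> \<le> norm (endo_apply (exp (h *\<^sub>R X) - 1) (emb f))"
        by (rule Lp_norm_prj_le)
      also have "\<dots> \<le> norm (exp (h *\<^sub>R X) - 1) * norm (emb f)"
        by (rule norm_endo_apply)
      also have "\<dots> \<le> norm (exp (h *\<^sub>R X) - 1) * 1"
        using f by (intro mult_left_mono) (auto simp: norm_emb)
      finally show "Lp_norm p (S h f - f) \<le> norm (exp (h *\<^sub>R X) - 1)"
        by simp
    qed
    have "((\<lambda>h. exp (h *\<^sub>R X)) \<longlongrightarrow> exp (0 *\<^sub>R X)) (at_right 0)"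
      using continuous_on_exp_endo[of "{0..}" X] unfolding continuous_on_def
      by (auto dest!: bspec[of _ _ 0] simp: at_within_Ici_at_right)
    then have "((\<lambda>h. norm (exp (h *\<^sub>R X) - 1)) \<longlongrightarrow> norm (exp (0 *\<^sub>R X) - 1)) (at_right 0)"
      by (intro tendsto_intros)
    then show "((\<lambda>h. norm (exp (h *\<^sub>R X) - 1)) \<longlongrightarrow> 0) (at_right 0)"
      by simp
  qed auto
  then show "uniformly_continuous_semigroup p S"
    unfolding uniformly_continuous_semigroup_def using bl
    by (auto simp: exp_endo_add exp_emb S_def)
  show "is_generator p A S"
    unfolding is_generator_def Lp_tendsto_iff
  proof (intro ballI conjI always_eventually allI)
    fix f assume f: "f \<in> Lp p"
    show "A f \<in> Lp p"
      using f by simp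
    show "(1 / h) *\<^sub>R (S h f - f) \<in> Lp p" for h
      unfolding S_def by (rule Lp_scaleR, rule Lp_diff[OF p prj_in_Lp f])
    have "((\<lambda>h. exp (h *\<^sub>R X)) has_vector_derivative X * exp (0 *\<^sub>R X)) (at 0 within {0<..})"
      by (rule has_vector_derivative_at_within[OF exp_scaleR_has_vector_derivative_left])
    then have "((\<lambda>h. endo_apply (exp (h *\<^sub>R X)) (emb f)) has_vector_derivative endo_apply X (emb f)) (at 0 within {0<..})"
      using endo.has_vector_derivative[OF _ has_vector_derivative_const[of "emb f"]]
      by (fastforce simp: endo.zero_right)
    then have "((\<lambda>h. (1 / h) *\<^sub>R (endo_apply (exp (h *\<^sub>R X)) (emb f) - emb f)) \<longlongrightarrow> emb (A f)) (at_right 0)"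
      using f by (simp add: has_vector_derivative_iff_quotient X)
    moreover have "emb ((1 / h) *\<^sub>R (S h f - f)) = (1 / h) *\<^sub>R (endo_apply (exp (h *\<^sub>R X)) (emb f) - emb f)" for h
      using f bl p by (simp add: emb_scaleR emb_diff emb_S[symmetric] Lp_diff Lp_bounded_linear_def)
    ultimately show "((\<lambda>h. emb ((1 / h) *\<^sub>R (S h f - f))) \<longlongrightarrow> emb (A f)) (at_right 0)"
      by simp
  qed
qed

text \<open>The uniqueness half: whichever semigroup \<open>SOME\<close> selects, on
  \<open>Lp p\<close> and for nonnegative times it is the exponential.\<close>

lemma semigroup_eq_exp:
  assumes S: "uniformly_continuous_semigroup p S" and gen: "is_generator p A S"
    and t: "0 \<le> t" and f: "f \<in> Lp p"
  shows "emb (S t f) = endo_apply (exp (t *\<^sub>R X)) (emb f)"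
proof -
  have bl: "\<And>t. 0 \<le> t \<Longrightarrow> Lp_bounded_linear p (S t)"
    and S_0: "\<And>f. f \<in> Lp p \<Longrightarrow> S 0 f = f"
    and S_add: "\<And>s t f. 0 \<le> s \<Longrightarrow> 0 \<le> t \<Longrightarrow> f \<in> Lp p \<Longrightarrow> S (s + t) f = S s (S t f)"
    and S_lim: "((\<lambda>h. Lp_opnorm p (\<lambda>f. S h f - f)) \<longlongrightarrow> 0) (at_right 0)"
    using S by (auto simp: uniformly_continuous_semigroup_def)
  have S_in: "S t f \<in> Lp p" if "0 \<le> t" "f \<in> Lp p" for t f
    using bl[OF that(1)] that(2) by (simp add: Lp_bounded_linear_def)
  \<comment> \<open>extended by the identity on the complement of \<open>Lp p\<close>, so that \<open>V 0 = id\<close>\<close>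
  define V where "V s x = emb (S s (prj x)) + (x - emb (prj x))" for s x
  have V_diff: "V h x - x = emb (S h (prj x) - prj x)" if "0 \<le> h" for h x
    using S_in[OF that] by (simp add: V_def emb_diff)
  interpret V: bounded_operator_semigroup V "\<lambda>h. Lp_opnorm p (\<lambda>f. S h f - f)" X
  proof (rule bounded_operator_semigroup.intro)
    show "bounded_linear (V s)" if "0 \<le> s" for s
      unfolding V_def
      by (intro bounded_linear_add bounded_linear_sub bounded_linear_ident bounded_linear_emb_prj
          bounded_linear_prj_extension bl that)
    show "V 0 x = x" for x
      by (simp add: V_def S_0)
    show "V (s + t) x = V s (V t x)" if "0 \<le> s" "0 \<le> t" for s t x
      using that by (simp add: V_def S_add S_in)
    show "norm (V h x - x) \<le> Lp_opnorm p (\<lambda>f. S h f - f) * norm x" if "0 < h" for h x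
    proof -
      have bl': "Lp_bounded_linear p (\<lambda>f. S h f - f)"
        using that by (intro Lp_bounded_linear_diff_id bl) simp
      have "norm (V h x - x) = Lp_norm p (S h (prj x) - prj x)"
        using that p by (simp add: V_diff norm_emb Lp_diff S_in)
      also have "\<dots> \<le> Lp_opnorm p (\<lambda>f. S h f - f) * Lp_norm p (prj x)"
        by (rule Lp_norm_le_opnorm[OF bl']) simp
      also have "\<dots> \<le> Lp_opnorm p (\<lambda>f. S h f - f) * norm x"
        by (intro mult_left_mono Lp_norm_prj_le Lp_opnorm_nonneg bl')
      finally show ?thesis .
    qed
    \<comment> \<open>The part of \<open>x\<close> outside the range of \<open>emb\<close> is fixed
      by \<open>V h\<close> and drops out of the quotient, in accordance with \<open>X\<close>,
      which annihilates it.\<close>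
    show "((\<lambda>h. (1 / h) *\<^sub>R (V h x - x)) \<longlongrightarrow> endo_apply X x) (at_right 0)" for x
    proof -
      have "((\<lambda>h. emb ((1 / h) *\<^sub>R (S h (prj x) - prj x))) \<longlongrightarrow> endo_apply X x) (at_right 0)"
        using gen by (auto simp: is_generator_def Lp_tendsto_iff X)
      then show ?thesis
        by (rule Lim_transform_eventually)
          (use p in \<open>auto simp: eventually_at_filter V_diff emb_scaleR Lp_diff S_in\<close>)
    qed
  qed (rule S_lim)
  show ?thesis
    using V.V_eq_exp[OF t, of "emb f"] f by (simp add: V_def)
qed

lemma
  assumes "0 \<le> t" "f \<in> Lp p"
  shows Lp_semigroup_in_Lp: "Lp_semigroup p A t f \<in> Lp p"
    and emb_Lp_semigroup: "emb (Lp_semigroup p A t f) = endo_apply (exp (t *\<^sub>R X)) (emb f)"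
proof -
  have S: "uniformly_continuous_semigroup p (Lp_semigroup p A) \<and> is_generator p A (Lp_semigroup p A)"
    unfolding Lp_semigroup_def
    by (rule someI[where P = "\<lambda>S. uniformly_continuous_semigroup p S \<and> is_generator p A S", OF conjI[OF exp_is_semigroup]])
  then show "Lp_semigroup p A t f \<in> Lp p"
    using assms by (simp add: uniformly_continuous_semigroup_def Lp_bounded_linear_def)
  show "emb (Lp_semigroup p A t f) = endo_apply (exp (t *\<^sub>R X)) (emb f)"
    using S assms by (intro semigroup_eq_exp) auto
qed

end

subsection \<open>The Bochner integral of a continuous function\<close>

text \<open>Links the simple functions of \<open>Lp_has_integral\<close> with the gauge integral of
  embedded functions, for which the fundamental theorem of calculus is used.\<close>

lemma has_integral_simple_bochner_integral:
  fixes a b :: real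
  assumes \<sigma>: "simple_function (lebesgue_on {a..b}) \<sigma>" and Lp: "\<And>s. s \<in> {a..b} \<Longrightarrow> \<sigma> s \<in> Lp p"
  shows "((\<lambda>s. emb (\<sigma> s)) has_integral
    emb (Bochner_Integration.simple_bochner_integral (lebesgue_on {a..b}) \<sigma>)) {a..b}"
proof -
  let ?M = "lebesgue_on {a..b}"
  define A where "A y = {s \<in> {a..b}. \<sigma> s = y}" for y
  have fin: "finite (\<sigma> ` {a..b})"
    using simple_functionD(1)[OF \<sigma>] by simp
  have A_sets: "A y \<in> sets ?M" for y
    using simple_functionD(2)[OF \<sigma>, of "{y}"] by (simp add: A_def vimage_def Int_def conj_commute)
  have interval: "{a..b} \<in> lmeasurable"
    by (metis cbox_interval lmeasurable_cbox)
  have A_meas: "A y \<in> lmeasurable" for y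
  proof (rule fmeasurableI2[of "{a..b}"])
    show "A y \<in> sets lebesgue"
    proof -
      obtain B where "A y = {a..b} \<inter> B" "B \<in> sets lebesgue"
        using A_sets[of y] unfolding sets_restrict_space by blast
      then show ?thesis
        using sets.Int[of "{a..b}" lebesgue B] by (simp add: fmeasurableD[OF interval])
    qed
  qed (use interval in \<open>auto simp: A_def\<close>)
  have int: "((\<lambda>s. \<Sum>y\<in>\<sigma> ` {a..b}. indicat_real (A y) s *\<^sub>R emb y) has_integral
      (\<Sum>y\<in>\<sigma> ` {a..b}. measure lebesgue (A y) *\<^sub>R emb y)) {a..b}"
  proof (intro has_integral_sum fin has_integral_scaleR_left)
    fix y
    have "(\<lambda>s. if s \<in> {a..b} then indicat_real (A y) s else 0) = indicat_real (A y)"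
      by (auto simp: A_def indicator_def)
    then show "(indicat_real (A y) has_integral measure lebesgue (A y)) {a..b}"
      using A_meas[of y] by (simp add: lmeasurable_iff_has_integral flip: has_integral_restrict_UNIV[where s = "{a..b}"])
  qed
  have decomp: "(\<Sum>y\<in>\<sigma> ` {a..b}. indicat_real (A y) s *\<^sub>R emb y) = emb (\<sigma> s)" if "s \<in> {a..b}" for s
  proof -
    have "(\<Sum>y\<in>\<sigma> ` {a..b}. indicat_real (A y) s *\<^sub>R emb y) = (\<Sum>y\<in>\<sigma> ` {a..b}. if y = \<sigma> s then emb (\<sigma> s) else 0)"
      using that by (intro sum.cong) (auto simp: A_def)
    then show ?thesis
      using fin that by simp
  qed
  have sum: "(\<Sum>y\<in>\<sigma> ` {a..b}. measure lebesgue (A y) *\<^sub>R emb y)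
      = emb (Bochner_Integration.simple_bochner_integral ?M \<sigma>)"
  proof -
    have "measure ?M {s \<in> space ?M. \<sigma> s = y} = measure lebesgue (A y)" for y
      by (subst measure_restrict_space) (auto simp: A_def)
    then have "Bochner_Integration.simple_bochner_integral ?M \<sigma> = (\<Sum>y\<in>\<sigma> ` {a..b}. measure lebesgue (A y) *\<^sub>R y)"
      by (simp add: Bochner_Integration.simple_bochner_integral_def)
    also have "emb \<dots> = (\<Sum>y\<in>\<sigma> ` {a..b}. emb (measure lebesgue (A y) *\<^sub>R y))"
      by (rule emb_sum) (use Lp in \<open>auto intro: Lp_scaleR\<close>)
    also have "\<dots> = (\<Sum>y\<in>\<sigma> ` {a..b}. measure lebesgue (A y) *\<^sub>R emb y)"
      by (rule sum.cong) (use Lp in \<open>auto simp: emb_scaleR\<close>)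
    finally show ?thesis
      by (rule sym)
  qed
  show ?thesis
    using has_integral_eq[OF decomp int] unfolding sum .
qed

text \<open>\<open>F\<close> is sampled on ever finer grids. Uniform continuity on the compact
  interval makes the step functions uniformly close to \<open>F\<close>, which settles both limits
  in \<open>Lp_has_integral\<close>.\<close>

lemma Lp_has_integral_continuous:
  fixes t :: real
  assumes t: "0 \<le> t" and F: "\<And>s. s \<in> {0..t} \<Longrightarrow> F s \<in> Lp p"
    and cont: "continuous_on {0..t} (\<lambda>s. emb (F s))"
    and I: "I \<in> Lp p" and int: "((\<lambda>s. emb (F s)) has_integral emb I) {0..t}"
  shows "Lp_has_integral p (lebesgue_on {0..t}) F I"
proof -
  let ?M = "lebesgue_on {0..t}"
  interpret M: finite_measure ?M
    by (metis cbox_interval finite_measure_lebesgue_on lmeasurable_cbox)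
  \<comment> \<open>\<open>\<pi> n\<close> rounds down to the grid of mesh
    \<open>1 / real (Suc n)\<close>. Rounding down keeps the sample point in \<open>{0..t}\<close>,
    since 0 belongs to the grid.\<close>
  define \<pi> :: "nat \<Rightarrow> real \<Rightarrow> real" where "\<pi> n s = real_of_int \<lfloor>s * real (Suc n)\<rfloor> / real (Suc n)" for n s
  have \<pi>_close: "\<bar>\<pi> n s - s\<bar> \<le> 1 / real (Suc n)" and \<pi>_le: "\<pi> n s \<le> s" for n s
  proof -
    define d where "d = real_of_int \<lfloor>s * real (Suc n)\<rfloor> - s * real (Suc n)"
    have d: "\<pi> n s - s = d / real (Suc n)"
      by (simp add: \<pi>_def d_def diff_divide_distrib)
    have "\<bar>d\<bar> \<le> 1" "d \<le> 0"
      unfolding d_def by linarith+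
    then show "\<bar>\<pi> n s - s\<bar> \<le> 1 / real (Suc n)"
      unfolding d abs_divide abs_of_nat by (intro divide_right_mono) auto
    have "\<pi> n s - s \<le> 0"
      unfolding d using \<open>d \<le> 0\<close> by (intro divide_nonpos_pos) auto
    then show "\<pi> n s \<le> s"
      by simp
  qed
  have \<pi>_in: "\<pi> n s \<in> {0..t}" if "s \<in> {0..t}" for n s
    using \<pi>_le[of n s] that by (auto simp: \<pi>_def)
  define \<sigma> where "\<sigma> n s = F (\<pi> n s)" for n s
  have \<sigma>_in: "\<sigma> n s \<in> Lp p" if "s \<in> {0..t}" for n s
    using F \<pi>_in that by (simp add: \<sigma>_def)
  have \<sigma>_simple: "simple_function ?M (\<sigma> n)" for n
  proof -
    have "simple_function ?M (\<pi> n)"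
    proof (rule simple_function_borel_measurable)
      show "\<pi> n \<in> borel_measurable ?M"
        unfolding \<pi>_def by (intro measurable_restrict_space1 measurable_completion) measurable
      have "\<pi> n ` {0..t} \<subseteq> (\<lambda>k. real_of_int k / real (Suc n)) ` {0..\<lfloor>t * real (Suc n)\<rfloor>}"
        by (auto simp: \<pi>_def intro!: imageI floor_mono mult_right_mono)
      then show "finite (\<pi> n ` space ?M)"
        unfolding space_lebesgue_on by (rule finite_surj[OF finite_atLeastAtMost_int])
    qed
    then have "simple_function ?M (F \<circ> \<pi> n)"
      by (rule simple_function_compose)
    then show ?thesis
      unfolding \<sigma>_def[abs_def] o_def .
  qed
  have close: "\<forall>\<^sub>F n in sequentially. \<forall>s\<in>{0..t}. norm (emb (F s) - emb (\<sigma> n s)) < e" if "0 < e" for e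
  proof -
    have "uniformly_continuous_on {0..t} (\<lambda>s. emb (F s))"
      by (intro compact_uniformly_continuous cont compact_Icc)
    then obtain d where d: "0 < d"
      "\<And>s s'. s \<in> {0..t} \<Longrightarrow> s' \<in> {0..t} \<Longrightarrow> dist s' s < d \<Longrightarrow> dist (emb (F s')) (emb (F s)) < e"
      using \<open>0 < e\<close> by (rule uniformly_continuous_onE) blast
    have "(\<lambda>n. 1 / real (Suc n)) \<longlonglongrightarrow> 0"
      using LIMSEQ_inverse_real_of_nat unfolding inverse_eq_divide .
    then have "\<forall>\<^sub>F n in sequentially. 1 / real (Suc n) < d"
      using d(1) by (rule order_tendstoD(2))
    then show ?thesis
    proof eventually_elim
      case (elim n)
      show ?case
      proof
        fix s assume s: "s \<in> {0..t}"
        have "dist (\<pi> n s) s < d"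
          using \<pi>_close[of n s] elim by (simp add: dist_real_def)
        from d(2)[OF s \<pi>_in[OF s] this] show "norm (emb (F s) - emb (\<sigma> n s)) < e"
          by (simp add: \<sigma>_def dist_norm norm_minus_commute)
      qed
    qed
  qed
  \<comment> \<open>The denominator \<open>t + 1\<close> in place of \<open>t\<close> admits
    \<open>t = 0\<close> and makes the inequality strict.\<close>
  have scale: "e / (t + 1) * t < e" if "0 < e" for e
  proof -
    have "e * t < e * (t + 1)"
      using that by (intro mult_strict_left_mono) auto
    then show ?thesis
      using t by (simp add: pos_divide_less_eq)
  qed
  show ?thesis
    unfolding Lp_has_integral_def
  proof (intro conjI ballI exI[of _ \<sigma>] allI)
    show "F s \<in> Lp p" if "s \<in> space ?M" for s
      using that F by simp
    show "\<sigma> n s \<in> Lp p" if "s \<in> space ?M" for n s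
      using that \<sigma>_in by simp
    show "(\<lambda>s. Lp_norm p (F s - g)) \<in> borel_measurable ?M" if g: "g \<in> Lp p" for g
    proof -
      have "(\<lambda>s. norm (emb (F s) - emb g)) \<in> borel_measurable ?M"
        by (intro continuous_imp_measurable_on_sets_lebesgue continuous_intros cont) auto
      then show ?thesis
        by (rule measurable_cong[THEN iffD1, rotated]) (use F g in \<open>simp add: Lp_norm_diff_emb\<close>)
    qed
    show "Bochner_Integration.simple_bochner_integrable ?M (\<sigma> n)" for n
      by (intro Bochner_Integration.simple_bochner_integrable.intros \<sigma>_simple) (simp add: M.emeasure_finite)
    show "(\<lambda>n. \<integral>\<^sup>+s. ennreal (Lp_norm p (F s - \<sigma> n s)) \<partial>?M) \<longlonglongrightarrow> 0"
    proof (rule order_tendstoI)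
      fix a :: ennreal assume "0 < a"
      then obtain b where b: "0 < b" "b < a"
        using dense by blast
      define e where "e = enn2real b"
      have b_eq: "b = ennreal e"
        using order_less_le_trans[OF b(2) top_greatest] by (simp add: e_def)
      have "0 < e"
        using b(1) by (simp add: b_eq)
      then have "\<forall>\<^sub>F n in sequentially. \<forall>s\<in>{0..t}. norm (emb (F s) - emb (\<sigma> n s)) < e / (t + 1)"
        using t by (intro close) simp
      then show "\<forall>\<^sub>F n in sequentially. (\<integral>\<^sup>+s. ennreal (Lp_norm p (F s - \<sigma> n s)) \<partial>?M) < a"
      proof eventually_elim
        case (elim n)
        have "(\<integral>\<^sup>+s. ennreal (Lp_norm p (F s - \<sigma> n s)) \<partial>?M) \<le> (\<integral>\<^sup>+s. ennreal (e / (t + 1)) \<partial>?M)"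
          using elim F \<sigma>_in by (intro nn_integral_mono ennreal_leI) (auto simp: Lp_norm_diff_emb less_imp_le)
        also have "\<dots> = ennreal (e / (t + 1)) * ennreal t"
          using t by (simp add: emeasure_restrict_space)
        also have "\<dots> = ennreal (e / (t + 1) * t)"
          using t \<open>0 < e\<close> by (intro ennreal_mult[symmetric]) auto
        also have "\<dots> \<le> ennreal e"
          using scale[OF \<open>0 < e\<close>] by (intro ennreal_leI) simp
        also have "\<dots> < a"
          using b(2) by (simp add: b_eq)
        finally show ?case .
      qed
    qed simp
    have "(\<lambda>n. emb (Bochner_Integration.simple_bochner_integral ?M (\<sigma> n))) \<longlonglongrightarrow> emb I"
    proof (rule tendstoI)
      fix e :: real assume "0 < e"
      then have "\<forall>\<^sub>F n in sequentially. \<forall>s\<in>{0..t}. norm (emb (F s) - emb (\<sigma> n s)) < e / (t + 1)"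
        using t by (intro close) simp
      then show "\<forall>\<^sub>F n in sequentially. dist (emb (Bochner_Integration.simple_bochner_integral ?M (\<sigma> n))) (emb I) < e"
      proof eventually_elim
        case (elim n)
        have "((\<lambda>s. emb (F s) - emb (\<sigma> n s)) has_integral
            emb I - emb (Bochner_Integration.simple_bochner_integral ?M (\<sigma> n))) {0..t}"
          by (intro has_integral_diff int has_integral_simple_bochner_integral \<sigma>_simple \<sigma>_in)
        then have "norm (emb I - emb (Bochner_Integration.simple_bochner_integral ?M (\<sigma> n)))
            \<le> e / (t + 1) * measure lborel {0..t}"
        proof (rule has_integral_bound_real[where S = "{}", rotated 2])
          show "0 \<le> e / (t + 1)"
            using t \<open>0 < e\<close> by simp
          show "norm (emb (F s) - emb (\<sigma> n s)) \<le> e / (t + 1)" if "s \<in> {0..t} - {}" for s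
            using elim that by (intro less_imp_le) auto
        qed simp
        also have "\<dots> = e / (t + 1) * t"
          using t by simp
        also have "\<dots> < e"
          using scale[OF \<open>0 < e\<close>] by simp
        finally show ?case
          by (simp add: dist_norm norm_minus_commute)
      qed
    qed
    moreover have "Bochner_Integration.simple_bochner_integral ?M (\<sigma> n) \<in> Lp p" for n
      unfolding Bochner_Integration.simple_bochner_integral_def
      using p \<sigma>_in by (intro Lp_sum) (auto intro: Lp_scaleR)
    ultimately show "Lp_tendsto p (\<lambda>n. Bochner_Integration.simple_bochner_integral ?M (\<sigma> n)) I sequentially"
      using I by (simp add: Lp_tendsto_iff)
  qed
qed

end

subsection \<open>The graphon reaction--diffusion equation\<close>

lemma (in graphon) Lp_bounded_linear_graphon_op:
  "1 \<le> p \<Longrightarrow> Lp_bounded_linear p (graphon_op W)"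
  unfolding Lp_bounded_linear_def
  by (intro conjI ballI allI exI[of _ 2])
    (simp_all add: graphon_op_Lp graphon_op_add graphon_op_scaleR graphon_op_norm)

theorem theorem3p8:
  fixes W :: "real \<Rightarrow> real \<Rightarrow> real" and \<Phi> :: "real \<Rightarrow> real"
    and K p T :: real and u0 :: L0
  assumes W_L1: "integrable (lebesgue_on ({0<..<1} \<times> {0<..<1})) (\<lambda>(x, y). W x y)"
    and W_sym: "\<And>x y. x \<in> {0<..<1} \<Longrightarrow> y \<in> {0<..<1} \<Longrightarrow> W x y = W y x"
    and W_nonneg: "\<And>x y. x \<in> {0<..<1} \<Longrightarrow> y \<in> {0<..<1} \<Longrightarrow> W x y \<ge> 0"
    and W_deg: "AE x in unit_leb. (\<integral>y. W x y \<partial>unit_leb) \<le> 1"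
    and \<Phi>_0: "\<Phi> 0 = 0"
    and \<Phi>_lipschitz: "K-lipschitz_on UNIV \<Phi>"
    and p: "1 \<le> p"
    and u0: "u0 \<in> Lp p"
    and T: "0 < T"
  shows "\<exists>u. classical_solution p W \<Phi> u0 T u \<and>
             (\<forall>v. classical_solution p W \<Phi> u0 T v \<longrightarrow> (\<forall>t\<in>{0..T}. v t = u t)) \<and>
             mild_formulation p W \<Phi> u0 T u"
proof -
  interpret graphon W
    by (unfold_locales) (fact W_L1 W_sym W_nonneg W_deg)+
  interpret Lp_space p
    by unfold_locales (fact p)
  let ?A = "graphon_op W" and ?N = "compose_L0 \<Phi>"
  note A = Lp_bounded_linear_graphon_op[OF p]
  have A_in [simp]: "f \<in> Lp p \<Longrightarrow> ?A f \<in> Lp p" and N_in [simp]: "f \<in> Lp p \<Longrightarrow> ?N f \<in> Lp p" for f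
    using graphon_op_Lp[OF p] compose_L0_in_Lp[OF p \<Phi>_0 \<Phi>_lipschitz] by auto
  obtain X where X: "\<And>x. endo_apply X x = emb (?A (prj x))"
    using endo_of_bounded_linear[OF bounded_linear_prj_extension[OF A]] by blast
  \<comment> \<open>The right-hand side transported to the whole space. It depends on
    \<open>x\<close> only through \<open>prj x\<close> and takes values in the range of
    \<open>emb\<close>.\<close>
  define G where "G x = endo_apply X x + emb (?N (prj x))" for x
  have G_emb: "G (emb f) = emb (?A f + ?N f)" if "f \<in> Lp p" for f
    using that by (simp add: G_def X emb_add)
  have G_prj: "G (emb (prj x)) = G x" and emb_prj_G: "emb (prj (G x)) = G x" for x
    by (simp_all add: G_def X emb_add)
  have N_lipschitz: "norm (emb (?N (prj x)) - emb (?N (prj y))) \<le> K * norm (x - y)" for x y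
  proof -
    have "norm (emb (?N (prj x)) - emb (?N (prj y))) \<le> K * Lp_norm p (prj x - prj y)"
      using compose_L0_diff_Lp(2)[OF p \<Phi>_lipschitz Lp_diff[OF p prj_in_Lp prj_in_Lp], of x y]
      by (simp add: Lp_norm_diff_emb)
    also have "\<dots> \<le> K * norm (x - y)"
      using Lp_norm_prj_le[of "x - y"] lipschitz_on_nonneg[OF \<Phi>_lipschitz] by (simp add: mult_left_mono)
    finally show ?thesis .
  qed
  \<comment> \<open>The summand 1 makes the constant positive, as \<open>lipschitz_ode\<close>
    demands, even when \<open>X\<close> and \<open>K\<close> vanish.\<close>
  have G_lipschitz: "norm (G x - G y) \<le> (norm X + K + 1) * norm (x - y)" for x y
  proof -
    have "G x - G y = endo_apply X (x - y) + (emb (?N (prj x)) - emb (?N (prj y)))"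
      by (simp add: G_def endo.diff_right)
    also have "norm \<dots> \<le> norm X * norm (x - y) + K * norm (x - y)"
      by (intro norm_triangle_mono norm_endo_apply N_lipschitz)
    also have "\<dots> \<le> (norm X + K + 1) * norm (x - y)"
      by (simp add: algebra_simps)
    finally show ?thesis .
  qed
  interpret ode: lipschitz_ode G "norm X + K + 1" T "emb u0"
    using G_lipschitz T lipschitz_on_nonneg[OF \<Phi>_lipschitz]
    by unfold_locales (auto intro: add_nonneg_pos)
  obtain w where w0: "w 0 = emb u0"
    and w: "\<And>t. t \<in> {0..T} \<Longrightarrow> (w has_vector_derivative G (w t)) (at t within {0..T})"
    and unique: "\<And>v t. v 0 = emb u0 \<Longrightarrow>
      (\<And>t. t \<in> {0..T} \<Longrightarrow> (v has_vector_derivative G (v t)) (at t within {0..T})) \<Longrightarrow>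
      t \<in> {0..T} \<Longrightarrow> v t = w t"
    by (rule ode.exists_unique_solution) blast
  define u where "u t = prj (w t)" for t
  have u_in [simp]: "u t \<in> Lp p" for t
    by (simp add: u_def)
  have u_0: "u 0 = u0"
    using u0 by (simp add: u_def w0)
  \<comment> \<open>The projected curve \<open>emb (prj (w t))\<close> solves the same initial value
    problem, so uniqueness keeps \<open>w\<close> in the range of \<open>emb\<close>.\<close>
  have emb_u: "emb (u t) = w t" if t: "t \<in> {0..T}" for t
    unfolding u_def
  proof (rule unique[OF _ _ t])
    show "emb (prj (w 0)) = emb u0"
      using u0 by (simp add: w0)
    show "((\<lambda>t. emb (prj (w t))) has_vector_derivative G (emb (prj (w t)))) (at t within {0..T})"
      if "t \<in> {0..T}" for t
      using bounded_linear.has_vector_derivative[OF bounded_linear_emb_prj w[OF that]]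
      by (simp add: G_prj emb_prj_G)
  qed
  have emb_rhs: "emb (?A (u t) + ?N (u t)) = G (w t)" if "t \<in> {0..T}" for t
    using that by (simp add: G_emb[symmetric] emb_u)
  have w_cont: "continuous_on {0..T} w"
    using w by (meson continuous_on_eq_continuous_within has_vector_derivative_continuous)
  have rhs_in: "?A f + ?N f \<in> Lp p" if "f \<in> Lp p" for f
    using p that by (simp add: Lp_add)
  have u_deriv: "Lp_has_derivative p u (?A (u t) + ?N (u t)) t {0..T}" if t: "t \<in> {0..T}" for t
  proof -
    have "((\<lambda>t. emb (u t)) has_vector_derivative G (w t)) (at t within {0..T})"
      by (rule has_vector_derivative_transform[OF t _ w[OF t]]) (simp add: emb_u)
    then show ?thesis
      using t by (simp add: Lp_has_derivative_iff rhs_in emb_rhs)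
  qed
  have "continuous_on {0..T} (\<lambda>t. emb (?A (u t) + ?N (u t)))"
    using continuous_on_compose2[OF ode.continuous_on_G w_cont subset_UNIV]
    by (rule continuous_on_eq) (simp add: emb_rhs)
  then have "Lp_continuous_on p {0..T} (\<lambda>t. ?A (u t) + ?N (u t))"
    by (simp add: Lp_continuous_on_iff rhs_in)
  then have classical: "classical_solution p W \<Phi> u0 T u"
    unfolding classical_solution_def Lp_C1_on_def using u_deriv u_0
    by (auto intro!: exI[of _ "\<lambda>t. ?A (u t) + ?N (u t)"])
  have "v t = u t" if v: "classical_solution p W \<Phi> u0 T v" and t: "t \<in> {0..T}" for v t
  proof -
    have v_in: "v t \<in> Lp p" if "t \<in> {0..T}" for t
      using v that by (simp add: classical_solution_def Lp_C1_on_def)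
    have "emb (v t) = w t"
    proof (rule unique[OF _ _ t])
      show "emb (v 0) = emb u0"
        using v by (simp add: classical_solution_def)
      show "((\<lambda>t. emb (v t)) has_vector_derivative G (emb (v t))) (at t within {0..T})" if "t \<in> {0..T}" for t
        using v that Lp_has_derivative_iff[of "{0..T}" v t "?A (v t) + ?N (v t)"]
        by (simp add: classical_solution_def v_in rhs_in G_emb)
    qed
    then show ?thesis
      using prj_emb[OF v_in[OF t]] by (simp add: u_def)
  qed
  moreover have "mild_formulation p W \<Phi> u0 T u"
    unfolding mild_formulation_def
  proof (intro ballI exI conjI)
    fix t assume t: "t \<in> {0..T}"
    define F where "F s = Lp_semigroup p ?A (t - s) (?N (u s))" for s
    let ?S = "Lp_semigroup p ?A t u0"
    \<comment> \<open>Chosen so that the mild identity holds by definition; what remains is that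
      \<open>I\<close> is the integral.\<close>
    define I where "I = u t - ?S"
    have S_in: "?S \<in> Lp p"
      using t u0 by (intro Lp_semigroup_in_Lp[OF A X]) auto
    have F_in: "F s \<in> Lp p" if "s \<in> {0..t}" for s
      unfolding F_def using that by (intro Lp_semigroup_in_Lp[OF A X]) auto
    have emb_F: "emb (F s) = endo_apply (exp ((t - s) *\<^sub>R X)) (emb (?N (prj (w s))))" if "s \<in> {0..t}" for s
      unfolding F_def using that by (subst emb_Lp_semigroup[OF A X]) (auto simp: u_def)
    have "continuous_on {0..t} (\<lambda>s. emb (?N (prj (w s))))"
    proof (rule continuous_on_compose2[where f = w and t = UNIV])
      show "continuous_on UNIV (\<lambda>x. emb (?N (prj x)))"
        by (rule lipschitz_on_continuous_on[where L = K])
          (use N_lipschitz lipschitz_on_nonneg[OF \<Phi>_lipschitz] in \<open>auto simp: lipschitz_on_def dist_norm\<close>)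
      show "continuous_on {0..t} w"
        using w_cont t by (auto intro: continuous_on_subset)
    qed auto
    then have "continuous_on {0..t} (\<lambda>s. endo_apply (exp ((t - s) *\<^sub>R X)) (emb (?N (prj (w s)))))"
      by (intro endo.continuous_on continuous_on_compose2[OF continuous_on_exp_endo[of UNIV]]
          continuous_intros subset_UNIV)
    then have F_cont: "continuous_on {0..t} (\<lambda>s. emb (F s))"
      by (rule continuous_on_eq) (simp add: emb_F)
    have int: "((\<lambda>s. endo_apply (exp ((t - s) *\<^sub>R X)) (emb (?N (prj (w s))))) has_integral
        endo_apply (exp ((t - t) *\<^sub>R X)) (w t) - endo_apply (exp ((t - 0) *\<^sub>R X)) (w 0)) {0..t}"
    proof (rule fundamental_theorem_of_calculus)
      fix s assume s: "s \<in> {0..t}"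
      have "(w has_vector_derivative G (w s)) (at s within {0..t})"
        using s t by (intro has_vector_derivative_within_subset[OF w]) auto
      then show "((\<lambda>s. endo_apply (exp ((t - s) *\<^sub>R X)) (w s)) has_vector_derivative
          endo_apply (exp ((t - s) *\<^sub>R X)) (emb (?N (prj (w s))))) (at s within {0..t})"
        unfolding G_def by (rule exp_endo_variation_of_constants)
    qed (use t in simp)
    \<comment> \<open>At the upper limit the exponential is the identity, at the lower one it is the
      semigroup at time \<open>t\<close> acting on \<open>u0\<close>.\<close>
    have I_eq: "endo_apply (exp ((t - t) *\<^sub>R X)) (w t) - endo_apply (exp ((t - 0) *\<^sub>R X)) (w 0) = emb I"
      unfolding I_def using t u0 S_in emb_Lp_semigroup[OF A X, of t u0]
      by (simp add: emb_diff emb_u w0)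
    have F_int: "((\<lambda>s. emb (F s)) has_integral emb I) {0..t}"
      using has_integral_eq[OF _ int[unfolded I_eq]] emb_F by simp
    show "Lp_has_integral p (lebesgue_on {0..t}) (\<lambda>s. Lp_semigroup p ?A (t - s) (?N (u s))) I"
      unfolding F_def[symmetric]
      using t p S_in by (intro Lp_has_integral_continuous F_in F_cont F_int) (auto simp: I_def intro: Lp_diff)
    show "u t = Lp_semigroup p ?A t u0 + I"
      by (simp add: I_def)
  qed
  ultimately show ?thesis
    using classical by blast
qed

end
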